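(* Let $V_1,\dots,V_k$ be finite-dimensional vector spaces over a field $\mathbb{F}$ and let $T\in\bigotimes_{i\in[k]}V_i$. Let $\mathcal{C}$ be a separating collection of partitions of $[k]$, and let $d_{\max}$ be the maximal rank of any $2$-flattening $\flat_{I,J}T$ with $\{I,J\}\in\mathcal{C}$. Then $\operatorname{rank}T\le d_{\max}^{2(k-1)}$.
   Context: All tensor products are over $\mathbb{F}$. For $I\subseteq[k]$, $V_I:=\bigotimes_{i\in I}V_i$. The rank of a tensor in $\bigotimes_{i\in[k]}V_i$ is the minimal number of pure tensors $v_1\otimes\cdots\otimes v_k$ ($v_i\in V_i$) summing to it. For a partition $\{I,J\}$ of $[k]$, the flattening $\flat_{I,J}T$ is $T$ viewed (via the canonical isomorphism) as an element of $V_I\otimes V_J$, and its rank is its rank as a $2$-tensor in $V_I\otimes V_J$ (i.e. a matrix rank). A collection $\mathcal{C}$ of partitions $\{I,J\}$ of $[k]$ into two non-empty parts is separating if for all $i\neq j$ in $[k]$ there is $\{I,J\}\in\mathcal{C}$ with $i\in I$ and $j\in J$. *)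

theory Defs
  imports "Jordan_Normal_Form.Missing_VectorSpace" "HOL-Algebra.AbelCoset" "HOL-Library.Disjoint_Sets"
begin

(* In the module records below the fields mult and one are never used; as for direct_sum in
   VectorSpace.SumSpaces they are filled with junk. *)

definition free_space :: "('a, 'm) ring_scheme \<Rightarrow> 'x set \<Rightarrow> ('a, 'x \<Rightarrow> 'a) module" where
  "free_space K X =
     \<lparr>carrier = {f. (\<forall>x. f x \<in> carrier K) \<and> finite {x. f x \<noteq> \<zero>\<^bsub>K\<^esub>} \<and> {x. f x \<noteq> \<zero>\<^bsub>K\<^esub>} \<subseteq> X},
      mult = (\<lambda>f g x. \<zero>\<^bsub>K\<^esub>),
      one = (\<lambda>x. \<zero>\<^bsub>K\<^esub>),
      zero = (\<lambda>x. \<zero>\<^bsub>K\<^esub>),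
      add = (\<lambda>f g x. f x \<oplus>\<^bsub>K\<^esub> g x),
      smult = (\<lambda>c f x. c \<otimes>\<^bsub>K\<^esub> f x)\<rparr>"

definition free_gen :: "('a, 'm) ring_scheme \<Rightarrow> 'x \<Rightarrow> ('x \<Rightarrow> 'a)" where
  "free_gen K x = (\<lambda>y. if y = x then \<one>\<^bsub>K\<^esub> else \<zero>\<^bsub>K\<^esub>)"

definition quotient_space ::
  "('a, 'm) ring_scheme \<Rightarrow> ('a, 'b, 'n) module_scheme \<Rightarrow> 'b set \<Rightarrow> ('a, 'b set) module" where
  "quotient_space K M N =
     \<lparr>carrier = a_rcosets\<^bsub>M\<^esub> N,
      mult = (\<lambda>A B. N),
      one = N,
      zero = N,
      add = (\<lambda>A B. A <+>\<^bsub>M\<^esub> B),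
      smult = (\<lambda>c A. \<Union>a\<in>A. N +>\<^bsub>M\<^esub> (c \<odot>\<^bsub>M\<^esub> a))\<rparr>"


section \<open>Tensor products\<close>

(* A family (V i), i \<in> S, is tensored over an arbitrary index set S, so that the construction
   can be iterated: the tensor products over the blocks of a partition of S are again a
   family of vector spaces, indexed by the blocks. *)

definition tuples :: "'i set \<Rightarrow> ('i \<Rightarrow> ('a, 'v, 'n) module_scheme) \<Rightarrow> ('i \<Rightarrow> 'v) set" where
  "tuples S V = (\<Pi>\<^sub>E i\<in>S. carrier (V i))"

definition multilinear_relations ::
  "('a, 'm) ring_scheme \<Rightarrow> 'i set \<Rightarrow> ('i \<Rightarrow> ('a, 'v, 'n) module_scheme) \<Rightarrow> (('i \<Rightarrow> 'v) \<Rightarrow> 'a) set" where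
  "multilinear_relations K S V =
     (let F = free_space K (tuples S V) in
       {free_gen K (u(i := x \<oplus>\<^bsub>V i\<^esub> y))
          \<ominus>\<^bsub>F\<^esub> (free_gen K (u(i := x)) \<oplus>\<^bsub>F\<^esub> free_gen K (u(i := y))) | u i x y.
          u \<in> tuples S V \<and> i \<in> S \<and> x \<in> carrier (V i) \<and> y \<in> carrier (V i)} \<union>
       {free_gen K (u(i := c \<odot>\<^bsub>V i\<^esub> x)) \<ominus>\<^bsub>F\<^esub> (c \<odot>\<^bsub>F\<^esub> free_gen K (u(i := x))) | u i c x.
          u \<in> tuples S V \<and> i \<in> S \<and> c \<in> carrier K \<and> x \<in> carrier (V i)})"

definition relation_space ::
  "('a, 'm) ring_scheme \<Rightarrow> 'i set \<Rightarrow> ('i \<Rightarrow> ('a, 'v, 'n) module_scheme) \<Rightarrow> (('i \<Rightarrow> 'v) \<Rightarrow> 'a) set" where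
  "relation_space K S V =
     LinearCombinations.module.span K (free_space K (tuples S V)) (multilinear_relations K S V)"

definition tensor_product ::
  "('a, 'm) ring_scheme \<Rightarrow> 'i set \<Rightarrow> ('i \<Rightarrow> ('a, 'v, 'n) module_scheme)
     \<Rightarrow> ('a, (('i \<Rightarrow> 'v) \<Rightarrow> 'a) set) module" where
  "tensor_product K S V = quotient_space K (free_space K (tuples S V)) (relation_space K S V)"

definition pure_tensor ::
  "('a, 'm) ring_scheme \<Rightarrow> 'i set \<Rightarrow> ('i \<Rightarrow> ('a, 'v, 'n) module_scheme)
     \<Rightarrow> ('i \<Rightarrow> 'v) \<Rightarrow> (('i \<Rightarrow> 'v) \<Rightarrow> 'a) set" where
  "pure_tensor K S V v = relation_space K S V +>\<^bsub>free_space K (tuples S V)\<^esub> free_gen K v"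

definition tensor_rank ::
  "('a, 'm) ring_scheme \<Rightarrow> 'i set \<Rightarrow> ('i \<Rightarrow> ('a, 'v, 'n) module_scheme)
     \<Rightarrow> (('i \<Rightarrow> 'v) \<Rightarrow> 'a) set \<Rightarrow> nat" where
  "tensor_rank K S V T =
     (LEAST r. \<exists>v. (\<forall>s<r. v s \<in> tuples S V) \<and>
        T = (\<Oplus>\<^bsub>tensor_product K S V\<^esub> s\<in>{..<r}. pure_tensor K S V (v s)))"


section \<open>Flattenings\<close>

definition block_products ::
  "('a, 'm) ring_scheme \<Rightarrow> ('i \<Rightarrow> ('a, 'v, 'n) module_scheme)
     \<Rightarrow> 'i set \<Rightarrow> ('a, (('i \<Rightarrow> 'v) \<Rightarrow> 'a) set) module" where
  "block_products K V = (\<lambda>B. tensor_product K B V)"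

(* For a partition P of S this is the canonical isomorphism from the tensor product over S to
   the tensor product, over the blocks B of P, of the tensor products over B. Pure tensors span,
   so the two conditions determine the map on the carrier, and outside it the values are
   irrelevant. For P = {I, J} the target is the tensor product of the I- and J-products. *)
definition flattening_map ::
  "('a, 'm) ring_scheme \<Rightarrow> 'i set \<Rightarrow> ('i \<Rightarrow> ('a, 'v, 'n) module_scheme) \<Rightarrow> 'i set set
     \<Rightarrow> (('i \<Rightarrow> 'v) \<Rightarrow> 'a) set \<Rightarrow> (('i set \<Rightarrow> (('i \<Rightarrow> 'v) \<Rightarrow> 'a) set) \<Rightarrow> 'a) set" where
  "flattening_map K S V P =
     (SOME \<phi>. \<phi> \<in> module_hom K (tensor_product K S V) (tensor_product K P (block_products K V)) \<and>
        (\<forall>v\<in>tuples S V.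
           \<phi> (pure_tensor K S V v) =
             pure_tensor K P (block_products K V) (\<lambda>B\<in>P. pure_tensor K B V (restrict v B))))"

definition flattening_rank ::
  "('a, 'm) ring_scheme \<Rightarrow> 'i set \<Rightarrow> ('i \<Rightarrow> ('a, 'v, 'n) module_scheme) \<Rightarrow> 'i set set
     \<Rightarrow> (('i \<Rightarrow> 'v) \<Rightarrow> 'a) set \<Rightarrow> nat" where
  "flattening_rank K S V P T = tensor_rank K P (block_products K V) (flattening_map K S V P T)"

definition separating_collection :: "'i set \<Rightarrow> 'i set set set \<Rightarrow> bool" where
  "separating_collection S C \<longleftrightarrow>
     (\<forall>P\<in>C. partition_on S P \<and> card P = 2) \<and>
     (\<forall>i\<in>S. \<forall>j\<in>S. i \<noteq> j \<longrightarrow> (\<exists>I J. {I, J} \<in> C \<and> i \<in> I \<and> j \<in> J))"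

end

(* In coordinates T becomes a function t on multi-indices, and a flattening of rank r along {P, Q}
   says that t(x on P, y on Q) is a matrix of rank at most r. By the CUR decomposition this matrix
   is a linear combination of at most r^2 products (column slice) * (row slice), that is, of
   products of a tensor over P and a tensor over Q obtained from T by freezing the other
   coordinates. Slices inherit every bound on flattening ranks. So induct on the index set I:
   choose a partition separating two elements of I and cut I into parts of sizes m and n; then
   rank <= d^2 * d^(2(m-1)) * d^(2(n-1)) = d^(2(m+n-1)), since tensors over one index have
   rank at most 1.
   Transport to the abstract tensor product uses its universal property: the coordinate forms
   of a basis are products of linear forms, and they separate tensors. *)

theory Submission
  imports Defs
begin

text \<open>Factoring a flattening of rank \<open>r\<close> into \<open>r\<close> products would
  cost only \<open>d\<close> per cut, but its factors are general linear combinations of slices, and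
  such combinations inherit no bound on their flattening ranks, so the induction could not continue.
  Insisting on slices on both sides leaves an \<open>r\<close> by \<open>r\<close> matrix of
  coefficients between them, and multiplying it out is what costs the square. This is the origin of
  the 2 in the exponent, while \<open>k - 1\<close> counts the binary cuts that reduce
  \<open>k\<close> indices to single ones. To keep the recursion free of changing domains, every
  function lives on the full set of multi-indices: a tensor over part of the indices is a function
  that ignores the others, and tensoring becomes pointwise multiplication. A cut is made by giving a
  slice two independent arguments, decomposing, and then setting both arguments equal.\<close>

section \<open>Sums of boundedly many functions\<close>

text \<open>The zero function counts as a sum of at most \<open>n\<close> members for every \<open>n\<close>; nothing is said outside \<open>D\<close>.\<close>

inductive sum_at_most ::
  "('a, 'm) ring_scheme \<Rightarrow> 'x set \<Rightarrow> ('x \<Rightarrow> 'a) set \<Rightarrow> nat \<Rightarrow> ('x \<Rightarrow> 'a) \<Rightarrow> bool"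
  for K D E where
  zero: "(\<And>x. x \<in> D \<Longrightarrow> f x = \<zero>\<^bsub>K\<^esub>) \<Longrightarrow> sum_at_most K D E n f"
| Suc: "e \<in> E \<Longrightarrow> sum_at_most K D E n g \<Longrightarrow> (\<And>x. x \<in> D \<Longrightarrow> f x = e x \<oplus>\<^bsub>K\<^esub> g x)
    \<Longrightarrow> sum_at_most K D E (Suc n) f"

lemma sum_at_most_cong:
  assumes "sum_at_most K D E n f" "\<And>x. x \<in> D \<Longrightarrow> f x = g x"
  shows "sum_at_most K D E n g"
  using assms
proof (induction arbitrary: g)
  case (zero f n)
  then show ?case by (intro sum_at_most.zero) metis
next
  case (Suc e n g' f)
  show ?case
    by (rule sum_at_most.Suc[OF Suc(1,2)]) (metis Suc(3,5))
qed

lemma sum_at_most_mono: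
  assumes "sum_at_most K D E m f" "m \<le> n"
  shows "sum_at_most K D E n f"
  using assms
proof (induction arbitrary: n)
  case (Suc e m g f)
  then obtain n' where "n = Suc n'" "m \<le> n'" by (metis Suc_le_D Suc_le_mono)
  with Suc show ?case by (auto intro: sum_at_most.Suc)
qed (auto intro: sum_at_most.zero)

text \<open>Indexed by \<open>J\<close> rather than given by a set of functions, so that
  \<open>card J\<close> counts summands. Agreement is demanded only on \<open>D\<close>, which lets
  members be given by any formula correct there.\<close>

definition lin_combs ::
  "('a, 'm) ring_scheme \<Rightarrow> 'x set \<Rightarrow> 'j set \<Rightarrow> ('j \<Rightarrow> 'x \<Rightarrow> 'a) \<Rightarrow> ('x \<Rightarrow> 'a) set" where
  "lin_combs K D J h =
     {f. \<exists>u \<in> J \<rightarrow> carrier K. \<forall>x\<in>D. f x = (\<Oplus>\<^bsub>K\<^esub> j\<in>J. u j \<otimes>\<^bsub>K\<^esub> h j x)}"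

context cring
begin

lemma sum_at_most_closed:
  assumes "sum_at_most R D E n f" "E \<subseteq> D \<rightarrow> carrier R"
  shows "f \<in> D \<rightarrow> carrier R"
  using assms
proof (induction)
  case (Suc e n g f)
  then have "e \<in> D \<rightarrow> carrier R" "g \<in> D \<rightarrow> carrier R" by auto
  with Suc(3) show ?case by (auto simp: Pi_iff)
qed auto

lemma sum_at_most_add:
  assumes "sum_at_most R D E m f" "sum_at_most R D E n g" "E \<subseteq> D \<rightarrow> carrier R"
  shows "sum_at_most R D E (m + n) (\<lambda>x. f x \<oplus> g x)"
  using assms(1)
proof (induction)
  case (zero f k)
  have "sum_at_most R D E n (\<lambda>x. f x \<oplus> g x)"
    by (rule sum_at_most_cong[OF assms(2)])
      (use zero sum_at_most_closed[OF assms(2,3)] in \<open>auto simp: Pi_iff\<close>)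
  then show ?case by (rule sum_at_most_mono) simp
next
  case (Suc e m f' f)
  show ?case
    unfolding add_Suc
  proof (rule sum_at_most.Suc[OF Suc(1) Suc(4)])
    fix x assume x: "x \<in> D"
    have "e x \<in> carrier R" "f' x \<in> carrier R" "g x \<in> carrier R"
      using x Suc(1) sum_at_most_closed[OF Suc(2) assms(3)] sum_at_most_closed[OF assms(2,3)] assms(3)
      by (auto simp: Pi_iff)
    then show "f x \<oplus> g x = e x \<oplus> (f' x \<oplus> g x)"
      using Suc(3)[OF x] by (simp add: a_assoc)
  qed
qed

lemma sum_at_most_smult:
  assumes "sum_at_most R D E n f" "E \<subseteq> D \<rightarrow> carrier R" "c \<in> carrier R"
    and "\<And>e. e \<in> E \<Longrightarrow> (\<lambda>x. c \<otimes> e x) \<in> E'"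
  shows "sum_at_most R D E' n (\<lambda>x. c \<otimes> f x)"
  using assms(1)
proof (induction)
  case (zero f n)
  then show ?case using assms(3) by (intro sum_at_most.zero) simp
next
  case (Suc e m f' f)
  show ?case
  proof (rule sum_at_most.Suc[OF assms(4)[OF Suc(1)] Suc(4)])
    fix x assume x: "x \<in> D"
    have "e x \<in> carrier R" "f' x \<in> carrier R"
      using x Suc(1) sum_at_most_closed[OF Suc(2) assms(2)] assms(2)
      by (auto simp: Pi_iff)
    then show "c \<otimes> f x = c \<otimes> e x \<oplus> c \<otimes> f' x"
      using Suc(3)[OF x] assms(3) by (simp add: r_distr)
  qed
qed

text \<open>Distributivity: each of the \<open>m\<close> summands of \<open>f\<close> meets each of
  the \<open>n\<close> summands of \<open>g\<close>. The three classes may differ, as for tensors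
  over two disjoint index sets and over their union.\<close>

lemma sum_at_most_mult:
  assumes "sum_at_most R D E1 m f" "sum_at_most R D E2 n g"
    and E: "E1 \<subseteq> D \<rightarrow> carrier R" "E2 \<subseteq> D \<rightarrow> carrier R" "E \<subseteq> D \<rightarrow> carrier R"
    and "\<And>e1 e2. e1 \<in> E1 \<Longrightarrow> e2 \<in> E2 \<Longrightarrow> (\<lambda>x. e1 x \<otimes> e2 x) \<in> E"
  shows "sum_at_most R D E (m * n) (\<lambda>x. f x \<otimes> g x)"
proof -
  have g: "g \<in> D \<rightarrow> carrier R" using sum_at_most_closed assms(2) E(2) .
  have step: "sum_at_most R D E n (\<lambda>x. e x \<otimes> g x)" if "e \<in> E1" for e
    using assms(2)
  proof (induction)
    case (zero g n)
    then show ?case using that E(1) by (intro sum_at_most.zero) (auto simp: Pi_iff subset_iff)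
  next
    case (Suc e2 m g' g)
    show ?case
    proof (rule sum_at_most.Suc[OF assms(6)[OF that Suc(1)] Suc(4)])
      fix x assume x: "x \<in> D"
      have "e2 x \<in> carrier R" "g' x \<in> carrier R" "e x \<in> carrier R"
        using x that Suc(1) sum_at_most_closed[OF Suc(2) E(2)] E
        by (auto simp: Pi_iff)
      then show "e x \<otimes> g x = e x \<otimes> e2 x \<oplus> e x \<otimes> g' x"
        using Suc(3)[OF x] by (simp add: r_distr)
    qed
  qed
  show ?thesis
    using assms(1)
  proof (induction)
    case (zero f n)
    then show ?case using g by (intro sum_at_most.zero) (auto simp: Pi_iff)
  next
    case (Suc e m f' f)
    show ?case unfolding mult_Suc
    proof (rule sum_at_most_cong[OF sum_at_most_add[OF step[OF Suc(1)] Suc(4) E(3)]])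
      fix x assume x: "x \<in> D"
      have "e x \<in> carrier R" "f' x \<in> carrier R" "g x \<in> carrier R"
        using x Suc(1) sum_at_most_closed[OF Suc(2) E(1)] E g
        by (auto simp: Pi_iff)
      then show "e x \<otimes> g x \<oplus> f' x \<otimes> g x = f x \<otimes> g x"
        using Suc(3)[OF x] by (simp add: l_distr)
    qed
  qed
qed

section \<open>Linear combinations of a finite family of functions\<close>

lemma lin_combs_add:
  assumes "f \<in> lin_combs R D J h" "g \<in> lin_combs R D J h" "h \<in> J \<rightarrow> D \<rightarrow> carrier R"
  shows "(\<lambda>x. f x \<oplus> g x) \<in> lin_combs R D J h"
proof -
  obtain u v where u: "u \<in> J \<rightarrow> carrier R" "\<And>x. x \<in> D \<Longrightarrow> f x = (\<Oplus> j\<in>J. u j \<otimes> h j x)"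
    and v: "v \<in> J \<rightarrow> carrier R" "\<And>x. x \<in> D \<Longrightarrow> g x = (\<Oplus> j\<in>J. v j \<otimes> h j x)"
    using assms unfolding lin_combs_def by auto
  have "f x \<oplus> g x = (\<Oplus> j\<in>J. (u j \<oplus> v j) \<otimes> h j x)" if x: "x \<in> D" for x
  proof -
    have "f x \<oplus> g x = (\<Oplus> j\<in>J. u j \<otimes> h j x \<oplus> v j \<otimes> h j x)"
      unfolding u(2)[OF x] v(2)[OF x] using u(1) v(1) assms(3) x
      by (subst finsum_addf) (auto simp: Pi_iff)
    also have "\<dots> = (\<Oplus> j\<in>J. (u j \<oplus> v j) \<otimes> h j x)"
      using u(1) v(1) assms(3) x by (intro finsum_cong') (auto simp: Pi_iff l_distr)
    finally show ?thesis .
  qed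
  then show ?thesis
    unfolding lin_combs_def using u(1) v(1)
    by (auto intro!: bexI[of _ "\<lambda>j. u j \<oplus> v j"])
qed

lemma lin_combs_smult:
  assumes "finite J" "f \<in> lin_combs R D J h" "c \<in> carrier R" "h \<in> J \<rightarrow> D \<rightarrow> carrier R"
  shows "(\<lambda>x. c \<otimes> f x) \<in> lin_combs R D J h"
proof -
  obtain u where u: "u \<in> J \<rightarrow> carrier R" "\<And>x. x \<in> D \<Longrightarrow> f x = (\<Oplus> j\<in>J. u j \<otimes> h j x)"
    using assms unfolding lin_combs_def by auto
  have "c \<otimes> f x = (\<Oplus> j\<in>J. (c \<otimes> u j) \<otimes> h j x)" if x: "x \<in> D" for x
  proof -
    have "c \<otimes> f x = (\<Oplus> j\<in>J. c \<otimes> (u j \<otimes> h j x))"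
      unfolding u(2)[OF x] using u(1) assms x
      by (subst finsum_rdistr) (auto simp: Pi_iff)
    also have "\<dots> = (\<Oplus> j\<in>J. (c \<otimes> u j) \<otimes> h j x)"
      using u(1) assms x by (intro finsum_cong') (auto simp: Pi_iff m_assoc)
    finally show ?thesis .
  qed
  then show ?thesis
    unfolding lin_combs_def using u(1) assms(3)
    by (auto intro!: bexI[of _ "\<lambda>j. c \<otimes> u j"])
qed

lemma lin_combs_base:
  assumes "finite J" "j \<in> J" "h \<in> J \<rightarrow> D \<rightarrow> carrier R"
  shows "h j \<in> lin_combs R D J h"
proof -
  have "h j x = (\<Oplus> i\<in>J. (if i = j then \<one> else \<zero>) \<otimes> h i x)" if x: "x \<in> D" for x
  proof -
    have "(\<Oplus> i\<in>J. (if i = j then \<one> else \<zero>) \<otimes> h i x) = (\<Oplus> i\<in>J. if j = i then h i x else \<zero>)"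
      using assms x by (intro finsum_cong') (auto simp: Pi_iff)
    also have "\<dots> = h j x"
      using assms x by (intro finsum_singleton) (auto simp: Pi_iff)
    finally show ?thesis by simp
  qed
  then show ?thesis
    unfolding lin_combs_def
    by (intro CollectI bexI[of _ "\<lambda>i. if i = j then \<one> else \<zero>"] ballI) (assumption | simp)+
qed

lemma lin_combs_zero:
  assumes "h \<in> J \<rightarrow> D \<rightarrow> carrier R"
  shows "(\<lambda>x. \<zero>) \<in> lin_combs R D J h"
proof -
  have "\<zero> = (\<Oplus> i\<in>J. \<zero> \<otimes> h i x)" if x: "x \<in> D" for x
  proof -
    have "(\<Oplus> i\<in>J. \<zero> \<otimes> h i x) = (\<Oplus> i\<in>J. \<zero>)"
      using assms x by (intro finsum_cong') (auto simp: Pi_iff)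
    then show ?thesis by simp
  qed
  then show ?thesis
    unfolding lin_combs_def by (auto intro!: bexI[of _ "\<lambda>i. \<zero>"])
qed

lemma lin_combs_cong:
  assumes "f \<in> lin_combs R D J h" "\<And>x. x \<in> D \<Longrightarrow> g x = f x"
  shows "g \<in> lin_combs R D J h"
proof -
  obtain u where "u \<in> J \<rightarrow> carrier R" "\<forall>x\<in>D. f x = (\<Oplus> j\<in>J. u j \<otimes> h j x)"
    using assms(1) unfolding lin_combs_def by auto
  then show ?thesis
    unfolding lin_combs_def using assms(2) by (intro CollectI bexI[of _ u]) simp_all
qed

lemma lin_combs_finsum:
  assumes "finite I" "finite J" "h \<in> J \<rightarrow> D \<rightarrow> carrier R"
    and "u \<in> I \<rightarrow> carrier R" "\<And>i. i \<in> I \<Longrightarrow> g i \<in> lin_combs R D J h"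
    and "\<And>i x. i \<in> I \<Longrightarrow> x \<in> D \<Longrightarrow> g i x \<in> carrier R"
  shows "(\<lambda>x. \<Oplus> i\<in>I. u i \<otimes> g i x) \<in> lin_combs R D J h"
  using assms(1,4-6)
proof (induction I)
  case empty
  then show ?case using assms(3) by (simp add: lin_combs_zero)
next
  case (insert i I)
  then have "(\<lambda>x. u i \<otimes> g i x \<oplus> (\<Oplus> i\<in>I. u i \<otimes> g i x)) \<in> lin_combs R D J h"
    using assms(2,3) by (intro lin_combs_add lin_combs_smult) auto
  then show ?case
    by (rule lin_combs_cong) (use insert in \<open>auto intro!: finsum_insert simp: Pi_iff\<close>)
qed

text \<open>Combinations are substituted into a combination; this turns crosses of a reduced matrix
  into crosses of the original one.\<close>

lemma lin_combs_trans:
  assumes "f \<in> lin_combs R D I g" "finite I" "finite J"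
    and "h \<in> J \<rightarrow> D \<rightarrow> carrier R" "g \<in> I \<rightarrow> D \<rightarrow> carrier R"
    and "\<And>i. i \<in> I \<Longrightarrow> g i \<in> lin_combs R D J h"
  shows "f \<in> lin_combs R D J h"
proof -
  obtain u where u: "u \<in> I \<rightarrow> carrier R" "\<And>x. x \<in> D \<Longrightarrow> f x = (\<Oplus> i\<in>I. u i \<otimes> g i x)"
    using assms unfolding lin_combs_def by auto
  have "(\<lambda>x. \<Oplus> i\<in>I. u i \<otimes> g i x) \<in> lin_combs R D J h"
    using assms u by (intro lin_combs_finsum) (auto simp: Pi_iff)
  then show ?thesis by (rule lin_combs_cong) (rule u(2))
qed

text \<open>Coefficients are absorbed into the members of \<open>E\<close>, so only the number of
  terms of the combination is paid for.\<close>

lemma sum_at_most_lin_combs: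
  assumes "finite J" "f \<in> lin_combs R D J h"
    and E: "E \<subseteq> D \<rightarrow> carrier R"
    and smult: "\<And>c e. c \<in> carrier R \<Longrightarrow> e \<in> E \<Longrightarrow> (\<lambda>x. c \<otimes> e x) \<in> E"
    and h: "\<And>j. j \<in> J \<Longrightarrow> sum_at_most R D E n (h j)"
  shows "sum_at_most R D E (card J * n) f"
proof -
  obtain u where u: "u \<in> J \<rightarrow> carrier R" "\<And>x. x \<in> D \<Longrightarrow> f x = (\<Oplus> j\<in>J. u j \<otimes> h j x)"
    using assms unfolding lin_combs_def by auto
  have "sum_at_most R D E (card J * n) (\<lambda>x. \<Oplus> j\<in>J. u j \<otimes> h j x)"
    using assms(1) u(1) h
  proof (induction J)
    case empty
    then show ?case by (auto intro: sum_at_most.zero)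
  next
    case (insert j J)
    have hc: "h i \<in> D \<rightarrow> carrier R" if "i \<in> insert j J" for i
      using sum_at_most_closed[OF insert(5)[OF that] E] .
    have "sum_at_most R D E (n + card J * n) (\<lambda>x. u j \<otimes> h j x \<oplus> (\<Oplus> j\<in>J. u j \<otimes> h j x))"
      using insert E smult by (intro sum_at_most_add sum_at_most_smult[where E = E]) auto
    then have "sum_at_most R D E (n + card J * n) (\<lambda>x. \<Oplus> j\<in>insert j J. u j \<otimes> h j x)"
      by (rule sum_at_most_cong)
        (use insert hc in \<open>auto intro!: finsum_insert[symmetric] simp: Pi_iff\<close>)
    then show ?case using insert by simp
  qed
  then show ?thesis by (rule sum_at_most_cong) (use u in auto)
qed

end

section \<open>CUR decomposition\<close>

context cring
begin

text \<open>Induction step for \<open>finsum_mult_expand\<close>, with the four partial sums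
  abstracted to \<open>A\<close>, \<open>B\<close>, \<open>C\<close>, \<open>D\<close> so that only
  a polynomial identity remains.\<close>

lemma mult_expand_identity:
  assumes "p \<in> carrier R" "p' \<in> carrier R" "q \<in> carrier R" "q' \<in> carrier R" "\<xi> \<in> carrier R" "\<eta> \<in> carrier R"
    "A \<in> carrier R" "B \<in> carrier R" "C \<in> carrier R" "D \<in> carrier R"
  shows "(p \<ominus> \<xi> \<otimes> p') \<otimes> (q \<ominus> \<eta> \<otimes> q') \<oplus> (A \<ominus> \<eta> \<otimes> B \<ominus> \<xi> \<otimes> C \<oplus> \<xi> \<otimes> \<eta> \<otimes> D)
    = p \<otimes> q \<oplus> A \<ominus> \<eta> \<otimes> (p \<otimes> q' \<oplus> B) \<ominus> \<xi> \<otimes> (p' \<otimes> q \<oplus> C) \<oplus> \<xi> \<otimes> \<eta> \<otimes> (p' \<otimes> q' \<oplus> D)"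
  using assms by algebra

lemma finsum_mult_expand:
  assumes "finite S" "p \<in> S \<rightarrow> carrier R" "p' \<in> S \<rightarrow> carrier R" "q \<in> S \<rightarrow> carrier R" "q' \<in> S \<rightarrow> carrier R"
    and "\<xi> \<in> carrier R" "\<eta> \<in> carrier R"
  shows "(\<Oplus>s\<in>S. (p s \<ominus> \<xi> \<otimes> p' s) \<otimes> (q s \<ominus> \<eta> \<otimes> q' s)) =
    (\<Oplus>s\<in>S. p s \<otimes> q s) \<ominus> \<eta> \<otimes> (\<Oplus>s\<in>S. p s \<otimes> q' s) \<ominus> \<xi> \<otimes> (\<Oplus>s\<in>S. p' s \<otimes> q s)
      \<oplus> \<xi> \<otimes> \<eta> \<otimes> (\<Oplus>s\<in>S. p' s \<otimes> q' s)"
  using assms(1-5)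
proof (induction S)
  case empty
  show ?case using assms(6,7) by (simp add: minus_eq)
next
  case (insert s S)
  have c: "p s \<in> carrier R" "p' s \<in> carrier R" "q s \<in> carrier R" "q' s \<in> carrier R"
    using insert by auto
  have "(\<Oplus>s\<in>S. p s \<otimes> q s) \<in> carrier R" "(\<Oplus>s\<in>S. p s \<otimes> q' s) \<in> carrier R"
    "(\<Oplus>s\<in>S. p' s \<otimes> q s) \<in> carrier R" "(\<Oplus>s\<in>S. p' s \<otimes> q' s) \<in> carrier R"
    using insert by (auto intro!: finsum_closed simp: Pi_iff)
  moreover have "(\<Oplus>s\<in>insert s S. (p s \<ominus> \<xi> \<otimes> p' s) \<otimes> (q s \<ominus> \<eta> \<otimes> q' s)) =
    (p s \<ominus> \<xi> \<otimes> p' s) \<otimes> (q s \<ominus> \<eta> \<otimes> q' s) \<oplus> (\<Oplus>s\<in>S. (p s \<ominus> \<xi> \<otimes> p' s) \<otimes> (q s \<ominus> \<eta> \<otimes> q' s))"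
    using insert assms(6,7) by (intro finsum_insert) (auto simp: Pi_iff)
  moreover have "(\<Oplus>s\<in>insert s S. f s \<otimes> g s) = f s \<otimes> g s \<oplus> (\<Oplus>s\<in>S. f s \<otimes> g s)"
    if "f \<in> insert s S \<rightarrow> carrier R" "g \<in> insert s S \<rightarrow> carrier R" for f g
    using insert that by (intro finsum_insert) (auto simp: Pi_iff)
  ultimately show ?case
    using insert.IH insert.prems c assms(6,7) by (simp add: mult_expand_identity)
qed

text \<open>In the application \<open>d\<close> is the inverse of the pivot \<open>A\<close>, so the
  last summand vanishes. \<open>P\<close> and \<open>Y\<close> are the sums without the removed term
  at \<open>(x, y)\<close> and \<open>(x0, y)\<close>, \<open>X\<close> is the matrix entry at
  \<open>(x, y0)\<close>, and the Greek letters come from the removed term.\<close>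

lemma wedderburn_identity:
  assumes "P \<in> carrier R" "X \<in> carrier R" "Y \<in> carrier R" "\<alpha> \<in> carrier R" "\<alpha>0 \<in> carrier R"
    "\<beta>0 \<in> carrier R" "\<gamma> \<in> carrier R" "d \<in> carrier R" "A \<in> carrier R"
  shows "P \<ominus> \<gamma> \<otimes> (X \<ominus> \<alpha> \<otimes> \<beta>0) \<ominus> (X \<otimes> d) \<otimes> Y \<oplus> (X \<otimes> d) \<otimes> \<gamma> \<otimes> (A \<ominus> \<alpha>0 \<otimes> \<beta>0)
    = P \<oplus> \<alpha> \<otimes> (\<gamma> \<otimes> \<beta>0) \<ominus> d \<otimes> (X \<otimes> (Y \<oplus> \<alpha>0 \<otimes> (\<gamma> \<otimes> \<beta>0))) \<oplus> X \<otimes> \<gamma> \<otimes> (d \<otimes> A \<ominus> \<one>)"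
  using assms by algebra

end

section \<open>Rank reduction by a pivot and cross decomposition\<close>

context field
begin

text \<open>Let \<open>L\<close> send a function \<open>f\<close> to
  \<open>f x - A x y0 * d * f x0\<close>, with \<open>d\<close> the inverse of the pivot. Applied in
  the first variable, \<open>L\<close> turns \<open>A\<close> into the reduced matrix, and it kills
  column \<open>y0\<close>. Hence the sum of \<open>b s y0\<close> times \<open>L (a s)\<close> is
  zero; since \<open>b s0 y0\<close> is nonzero for some \<open>s0\<close>, the function
  \<open>L (a s0)\<close> is a combination of the others, and its term can be eliminated.\<close>

lemma wedderburn_rank_reduction:
  assumes S: "finite S" "a \<in> S \<rightarrow> X \<rightarrow> carrier R" "b \<in> S \<rightarrow> Y \<rightarrow> carrier R"
    and A: "\<And>x y. x \<in> X \<Longrightarrow> y \<in> Y \<Longrightarrow> A x y = (\<Oplus>s\<in>S. a s x \<otimes> b s y)"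
    and pivot: "x0 \<in> X" "y0 \<in> Y" "A x0 y0 \<noteq> \<zero>"
  obtains s0 a' b' where "s0 \<in> S" "a' \<in> S - {s0} \<rightarrow> X \<rightarrow> carrier R" "b' \<in> S - {s0} \<rightarrow> Y \<rightarrow> carrier R"
    "\<And>x y. x \<in> X \<Longrightarrow> y \<in> Y \<Longrightarrow>
      A x y \<ominus> inv (A x0 y0) \<otimes> (A x y0 \<otimes> A x0 y) = (\<Oplus>s\<in>S - {s0}. a' s x \<otimes> b' s y)"
proof -
  have "\<exists>s0\<in>S. b s0 y0 \<noteq> \<zero>"
  proof (rule ccontr)
    assume "\<not> ?thesis"
    then have "A x0 y0 = (\<Oplus>s\<in>S. \<zero>)"
      unfolding A[OF pivot(1,2)] using S pivot by (intro finsum_cong') (auto simp: Pi_iff)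
    then show False using pivot(3) by simp
  qed
  then obtain s0 where s0: "s0 \<in> S" "b s0 y0 \<noteq> \<zero>" by blast
  let ?S = "S - {s0}"
  have ac: "a s x \<in> carrier R" if "s \<in> S" "x \<in> X" for s x using S that by auto
  have bc: "b s y \<in> carrier R" if "s \<in> S" "y \<in> Y" for s y using S that by auto
  have Ac: "A x y \<in> carrier R" if "x \<in> X" "y \<in> Y" for x y
    unfolding A[OF that] using ac bc that by (auto intro!: finsum_closed)
  define d where "d = inv (A x0 y0)"
  have unit: "A x0 y0 \<in> Units R" "b s0 y0 \<in> Units R"
    using pivot s0 Ac bc by (auto simp: field_Units)
  have dc: "d \<in> carrier R" and d: "d \<otimes> A x0 y0 = \<one>" using unit by (auto simp: d_def)
  \<comment> \<open>The right factor of the eliminated term, normalised to 1 at \<open>y0\<close>;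
    multiples of it correct the other right factors.\<close>
  define c where "c y = b s0 y \<otimes> inv (b s0 y0)" for y
  have cc: "c y \<in> carrier R" if "y \<in> Y" for y using that s0 bc unit by (auto simp: c_def)
  have c: "b s0 y = c y \<otimes> b s0 y0" if "y \<in> Y" for y
    using that s0 bc pivot unit by (simp add: c_def m_assoc)
  have split: "A x y = (\<Oplus>s\<in>?S. a s x \<otimes> b s y) \<oplus> a s0 x \<otimes> b s0 y" if "x \<in> X" "y \<in> Y" for x y
  proof -
    have "A x y = (\<Oplus>s\<in>insert s0 ?S. a s x \<otimes> b s y)"
      using A[OF that] s0 by (simp add: insert_absorb)
    also have "\<dots> = a s0 x \<otimes> b s0 y \<oplus> (\<Oplus>s\<in>?S. a s x \<otimes> b s y)"
      using S ac bc that s0 by (intro finsum_insert) auto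
    also have "\<dots> = (\<Oplus>s\<in>?S. a s x \<otimes> b s y) \<oplus> a s0 x \<otimes> b s0 y"
      using ac bc that s0 by (intro a_comm) (auto intro!: finsum_closed)
    finally show ?thesis .
  qed
  have sc: "(\<Oplus>s\<in>?S. a s x \<otimes> b s y) \<in> carrier R" if "x \<in> X" "y \<in> Y" for x y
    using ac bc that by (auto intro!: finsum_closed)
  have split': "(\<Oplus>s\<in>?S. a s x \<otimes> b s y) = A x y \<ominus> a s0 x \<otimes> b s0 y" if "x \<in> X" "y \<in> Y" for x y
  proof -
    have "P = (P \<oplus> Q) \<ominus> Q" if "P \<in> carrier R" "Q \<in> carrier R" for P Q
      using that by algebra
    then show ?thesis using split[OF that] sc[OF that] ac bc that s0 by simp
  qed
  \<comment> \<open>The new left factors vanish at \<open>x0\<close> and the new right factors at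
    \<open>y0\<close>, just as the reduced matrix has zero row \<open>x0\<close> and zero column
    \<open>y0\<close>.\<close>
  show thesis
  proof (rule that[OF s0(1), of "\<lambda>s x. a s x \<ominus> (A x y0 \<otimes> d) \<otimes> a s x0" "\<lambda>s y. b s y \<ominus> c y \<otimes> b s y0"])
    fix x y assume xy: "x \<in> X" "y \<in> Y"
    let ?P = "\<Oplus>s\<in>?S. a s x \<otimes> b s y" and ?Y = "\<Oplus>s\<in>?S. a s x0 \<otimes> b s y"
    have "(\<Oplus>s\<in>?S. (a s x \<ominus> (A x y0 \<otimes> d) \<otimes> a s x0) \<otimes> (b s y \<ominus> c y \<otimes> b s y0)) =
      ?P \<ominus> c y \<otimes> (\<Oplus>s\<in>?S. a s x \<otimes> b s y0) \<ominus> (A x y0 \<otimes> d) \<otimes> ?Y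
        \<oplus> (A x y0 \<otimes> d) \<otimes> c y \<otimes> (\<Oplus>s\<in>?S. a s x0 \<otimes> b s y0)"
      using S(1) ac bc Ac cc dc xy pivot
      by (intro finsum_mult_expand) auto
    also have "\<dots> = ?P \<ominus> c y \<otimes> (A x y0 \<ominus> a s0 x \<otimes> b s0 y0) \<ominus> (A x y0 \<otimes> d) \<otimes> ?Y
        \<oplus> (A x y0 \<otimes> d) \<otimes> c y \<otimes> (A x0 y0 \<ominus> a s0 x0 \<otimes> b s0 y0)"
      using split' xy pivot by simp
    also have "\<dots> = ?P \<oplus> a s0 x \<otimes> (c y \<otimes> b s0 y0)
        \<ominus> d \<otimes> (A x y0 \<otimes> (?Y \<oplus> a s0 x0 \<otimes> (c y \<otimes> b s0 y0))) \<oplus> A x y0 \<otimes> c y \<otimes> (d \<otimes> A x0 y0 \<ominus> \<one>)"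
      using sc ac bc Ac cc dc xy pivot s0 by (intro wedderburn_identity) auto
    also have "\<dots> = A x y \<ominus> d \<otimes> (A x y0 \<otimes> A x0 y) \<oplus> A x y0 \<otimes> c y \<otimes> (\<one> \<ominus> \<one>)"
      by (simp only: c[OF xy(2), symmetric] d split[OF xy, symmetric] split[OF pivot(1) xy(2), symmetric])
    also have "\<dots> = A x y \<ominus> d \<otimes> (A x y0 \<otimes> A x0 y)"
      using xy pivot Ac[of x y] Ac[of x0 y] Ac[of x y0] cc dc by (simp add: minus_eq r_neg)
    finally show "A x y \<ominus> inv (A x0 y0) \<otimes> (A x y0 \<otimes> A x0 y) =
      (\<Oplus>s\<in>?S. (a s x \<ominus> (A x y0 \<otimes> d) \<otimes> a s x0) \<otimes> (b s y \<ominus> c y \<otimes> b s y0))"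
      unfolding d_def by simp
  qed (use ac bc Ac cc dc pivot in auto)
qed

text \<open>Induction on the rank: subtracting the cross through a nonzero entry lowers it by one.\<close>

lemma cross_decomposition:
  assumes "finite S" "a \<in> S \<rightarrow> X \<rightarrow> carrier R" "b \<in> S \<rightarrow> Y \<rightarrow> carrier R"
    and "\<And>x y. x \<in> X \<Longrightarrow> y \<in> Y \<Longrightarrow> A x y = (\<Oplus>s\<in>S. a s x \<otimes> b s y)"
  shows "\<exists>P Q. finite P \<and> finite Q \<and> P \<subseteq> X \<and> Q \<subseteq> Y \<and> card P \<le> card S \<and> card Q \<le> card S \<and>
    (\<lambda>(x, y). A x y) \<in> lin_combs R (X \<times> Y) (P \<times> Q) (\<lambda>(p, q) (x, y). A x q \<otimes> A p y)"
  using assms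
proof (induction "card S" arbitrary: S a b A)
  case (0 S a b A)
  then have "A x y = \<zero>" if "x \<in> X" "y \<in> Y" for x y using that by simp
  then have "(\<lambda>(x, y). A x y) \<in> lin_combs R (X \<times> Y) ({} \<times> {}) (\<lambda>(p, q) (x, y). A x q \<otimes> A p y)"
    by (auto simp: lin_combs_def)
  then show ?case by (intro exI[of _ "{}"]) auto
next
  case (Suc n S a b A)
  show ?case
  proof (cases "\<exists>x0\<in>X. \<exists>y0\<in>Y. A x0 y0 \<noteq> \<zero>")
    case False
    then have "A x y = \<zero>" if "x \<in> X" "y \<in> Y" for x y using that by simp
    then have "(\<lambda>(x, y). A x y) \<in> lin_combs R (X \<times> Y) ({} \<times> {}) (\<lambda>(p, q) (x, y). A x q \<otimes> A p y)"
      by (auto simp: lin_combs_def)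
    then show ?thesis by (intro exI[of _ "{}"]) auto
  next
    case True
    then obtain x0 y0 where pivot: "x0 \<in> X" "y0 \<in> Y" "A x0 y0 \<noteq> \<zero>" by auto
    have Ac: "A x y \<in> carrier R" if "x \<in> X" "y \<in> Y" for x y
      using Suc.prems that by (auto intro!: finsum_closed simp: Pi_iff)
    define d where "d = inv (A x0 y0)"
    have "A x0 y0 \<in> Units R" using pivot Ac by (auto simp: field_Units)
    then have dc: "d \<in> carrier R" by (auto simp: d_def)
    define A' where "A' x y = A x y \<ominus> d \<otimes> (A x y0 \<otimes> A x0 y)" for x y
    have A'c: "A' x y \<in> carrier R" if "x \<in> X" "y \<in> Y" for x y
      using that Ac dc pivot by (simp add: A'_def)
    obtain s0 a' b' where s0: "s0 \<in> S" "a' \<in> S - {s0} \<rightarrow> X \<rightarrow> carrier R" "b' \<in> S - {s0} \<rightarrow> Y \<rightarrow> carrier R"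
      and A': "\<And>x y. x \<in> X \<Longrightarrow> y \<in> Y \<Longrightarrow> A' x y = (\<Oplus>s\<in>S - {s0}. a' s x \<otimes> b' s y)"
      unfolding A'_def d_def
      by (rule wedderburn_rank_reduction[where A = A, OF Suc.prems(1-3) _ pivot])
        (use Suc.prems(4) in auto)
    have n: "n = card (S - {s0})" "finite (S - {s0})" using Suc.hyps(2) Suc.prems(1) s0 by auto
    obtain P Q where PQ: "finite P" "finite Q" "P \<subseteq> X" "Q \<subseteq> Y" "card P \<le> n" "card Q \<le> n"
      "(\<lambda>(x, y). A' x y) \<in> lin_combs R (X \<times> Y) (P \<times> Q) (\<lambda>(p, q) (x, y). A' x q \<otimes> A' p y)"
      using Suc.hyps(1)[OF n s0(2,3) A', folded n(1)] by blast
    define J where "J = insert x0 P \<times> insert y0 Q"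
    define h where "h = (\<lambda>(p, q) (x, y). A x q \<otimes> A p y)"
    have J: "finite J" "J \<subseteq> X \<times> Y" using PQ pivot by (auto simp: J_def)
    have h: "h \<in> J \<rightarrow> X \<times> Y \<rightarrow> carrier R" using J Ac by (auto simp: h_def)
    note closure = lin_combs_add[OF _ _ h] lin_combs_smult[OF J(1) _ _ h] lin_combs_base[OF J(1) _ h]
    have base: "(\<lambda>(x, y). A x q \<otimes> A p y) \<in> lin_combs R (X \<times> Y) J h" if "(p, q) \<in> J" for p q
      using closure(3)[OF that] by (simp add: h_def)
    \<comment> \<open>Column \<open>q\<close> of \<open>A'\<close> is column \<open>q\<close> of
      \<open>A\<close> plus a multiple of column \<open>y0\<close>, and row \<open>p\<close>
      likewise involves row \<open>x0\<close>; so a cross of \<open>A'\<close> is a combination of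
      four crosses of \<open>A\<close>.\<close>
    have "(\<lambda>(x, y). A' x q \<otimes> A' p y) \<in> lin_combs R (X \<times> Y) J h" if pq: "p \<in> P" "q \<in> Q" for p q
    proof -
      have pqc: "p \<in> X" "q \<in> Y" using pq PQ by auto
      define \<beta> \<gamma> where "\<beta> = \<ominus> (d \<otimes> A x0 q)" and "\<gamma> = \<ominus> (d \<otimes> A p y0)"
      have coeffs: "\<beta> \<in> carrier R" "\<gamma> \<in> carrier R"
        using pqc Ac dc pivot by (auto simp: \<beta>_def \<gamma>_def)
      have "(\<lambda>z. ((case z of (x, y) \<Rightarrow> A x q \<otimes> A p y)
          \<oplus> \<beta> \<otimes> (case z of (x, y) \<Rightarrow> A x y0 \<otimes> A p y))
          \<oplus> (\<gamma> \<otimes> (case z of (x, y) \<Rightarrow> A x q \<otimes> A x0 y)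
          \<oplus> (\<beta> \<otimes> \<gamma>) \<otimes> (case z of (x, y) \<Rightarrow> A x y0 \<otimes> A x0 y)))
        \<in> lin_combs R (X \<times> Y) J h" (is "?f \<in> _")
        using coeffs pq by (intro closure(1) closure(2) base) (auto simp: J_def)
      then show ?thesis
      proof (rule lin_combs_cong)
        fix z assume "z \<in> X \<times> Y"
        then obtain x y where z: "z = (x, y)" "x \<in> X" "y \<in> Y" by auto
        have "(u \<ominus> d \<otimes> (v \<otimes> w)) \<otimes> (u' \<ominus> d \<otimes> (v' \<otimes> w')) =
          (u \<otimes> u' \<oplus> (\<ominus> (d \<otimes> w)) \<otimes> (v \<otimes> u')) \<oplus> ((\<ominus> (d \<otimes> v')) \<otimes> (u \<otimes> w') \<oplus> ((\<ominus> (d \<otimes> w)) \<otimes> (\<ominus> (d \<otimes> v'))) \<otimes> (v \<otimes> w'))"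
          if "u \<in> carrier R" "v \<in> carrier R" "w \<in> carrier R" "u' \<in> carrier R" "v' \<in> carrier R" "w' \<in> carrier R"
          for u v w u' v' w'
          using that dc by algebra
        then show "(case z of (x, y) \<Rightarrow> A' x q \<otimes> A' p y) = ?f z"
          using z pqc pivot Ac dc by (simp add: A'_def \<beta>_def \<gamma>_def)
      qed
    qed
    then have "(\<lambda>(x, y). A' x y) \<in> lin_combs R (X \<times> Y) J h"
      using PQ A'c J h by (intro lin_combs_trans[OF PQ(7)]) (auto simp: subset_iff)
    \<comment> \<open>\<open>A\<close> is \<open>A'\<close> plus \<open>d\<close> times the cross of
      \<open>A\<close> through the pivot, and \<open>J\<close> contains that cross too.\<close>
    then have "(\<lambda>z. (case z of (x, y) \<Rightarrow> A' x y) \<oplus> d \<otimes> (case z of (x, y) \<Rightarrow> A x y0 \<otimes> A x0 y))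
        \<in> lin_combs R (X \<times> Y) J h" (is "?f \<in> _")
      using dc by (intro closure(1) closure(2) base) (auto simp: J_def)
    then have "(\<lambda>(x, y). A x y) \<in> lin_combs R (X \<times> Y) J h"
    proof (rule lin_combs_cong)
      fix z assume "z \<in> X \<times> Y"
      then obtain x y where z: "z = (x, y)" "x \<in> X" "y \<in> Y" by auto
      have "u = (u \<ominus> v) \<oplus> v" if "u \<in> carrier R" "v \<in> carrier R" for u v
        using that by algebra
      then show "(case z of (x, y) \<Rightarrow> A x y) = ?f z"
        using z pivot Ac dc by (simp add: A'_def)
    qed
    \<comment> \<open>One new row and one new column, against the one term saved by the
      reduction.\<close>
    moreover have "card (insert x0 P) \<le> card S" "card (insert y0 Q) \<le> card S"
      using PQ Suc.hyps(2) by (auto simp: card_insert_if)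
    ultimately show ?thesis
      using PQ pivot unfolding J_def h_def
      by (intro exI[of _ "insert x0 P"] exI[of _ "insert y0 Q"]) simp
  qed
qed

end

section \<open>Slices of a function on multi-indices\<close>

text \<open>The coordinate functions of pure tensors over \<open>I\<close>, extended to all
  multi-indices over \<open>S\<close>; values outside \<open>PiE S B\<close> are left open.\<close>

definition product_functions ::
  "('a, 'm) ring_scheme \<Rightarrow> 'i set \<Rightarrow> ('i \<Rightarrow> 'x set) \<Rightarrow> 'i set \<Rightarrow> (('i \<Rightarrow> 'x) \<Rightarrow> 'a) set" where
  "product_functions K S B I =
     {f. \<exists>e. (\<forall>i\<in>I. e i \<in> B i \<rightarrow> carrier K) \<and>
       (\<forall>x \<in> PiE S B. f x = (\<Otimes>\<^bsub>K\<^esub> i\<in>I. e i (x i)))}"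

lemma override_on_PiE:
  "x \<in> PiE S B \<Longrightarrow> y \<in> PiE S B \<Longrightarrow> override_on y x I \<in> PiE S B"
  by (auto simp: override_on_def PiE_iff extensional_def)

context cring
begin

lemma product_functions_closed:
  assumes "I \<subseteq> S"
  shows "product_functions R S B I \<subseteq> PiE S B \<rightarrow> carrier R"
proof (intro subsetI Pi_I)
  fix f x assume f: "f \<in> product_functions R S B I" and x: "x \<in> PiE S B"
  obtain e where e: "\<And>i. i \<in> I \<Longrightarrow> e i \<in> B i \<rightarrow> carrier R" "f x = (\<Otimes> i\<in>I. e i (x i))"
    using f x unfolding product_functions_def by blast
  have "e i (x i) \<in> carrier R" if "i \<in> I" for i
    using e(1)[OF that] PiE_mem[OF x] that assms by blast
  then show "f x \<in> carrier R" unfolding e(2) by (intro finprod_closed) blast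
qed

lemma product_functions_mult:
  assumes "finite (I \<union> J)" "I \<inter> J = {}" "I \<union> J \<subseteq> S"
    and "f \<in> product_functions R S B I" "g \<in> product_functions R S B J"
  shows "(\<lambda>x. f x \<otimes> g x) \<in> product_functions R S B (I \<union> J)"
proof -
  obtain e where e: "\<And>i. i \<in> I \<Longrightarrow> e i \<in> B i \<rightarrow> carrier R" "\<And>x. x \<in> PiE S B \<Longrightarrow> f x = (\<Otimes> i\<in>I. e i (x i))"
    using assms(4) unfolding product_functions_def by blast
  obtain e' where e': "\<And>i. i \<in> J \<Longrightarrow> e' i \<in> B i \<rightarrow> carrier R" "\<And>x. x \<in> PiE S B \<Longrightarrow> g x = (\<Otimes> i\<in>J. e' i (x i))"
    using assms(5) unfolding product_functions_def by blast
  define k where "k i = (if i \<in> I then e i else e' i)" for i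
  have k: "k i \<in> B i \<rightarrow> carrier R" if "i \<in> I \<union> J" for i
    using that e(1) e'(1) unfolding k_def by (cases "i \<in> I") simp_all
  have "f x \<otimes> g x = (\<Otimes> i\<in>I \<union> J. k i (x i))" if x: "x \<in> PiE S B" for x
  proof -
    have kx: "k i (x i) \<in> carrier R" if "i \<in> I \<union> J" for i
      using k[OF that] PiE_mem[OF x] that assms(3) by blast
    have ex: "e i (x i) \<in> carrier R" if "i \<in> I" for i
      using e(1)[OF that] PiE_mem[OF x] that assms(3) by blast
    have e'x: "e' i (x i) \<in> carrier R" if "i \<in> J" for i
      using e'(1)[OF that] PiE_mem[OF x] that assms(3) by blast
    have "(\<Otimes> i\<in>I \<union> J. k i (x i)) = (\<Otimes> i\<in>I. k i (x i)) \<otimes> (\<Otimes> i\<in>J. k i (x i))"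
      using assms kx by (intro finprod_Un_disjoint) blast+
    also have "(\<Otimes> i\<in>I. k i (x i)) = f x"
      unfolding e(2)[OF x]
      by (intro finprod_cong') (use ex in \<open>auto simp: k_def\<close>)
    also have "(\<Otimes> i\<in>J. k i (x i)) = g x"
      unfolding e'(2)[OF x]
      by (intro finprod_cong') (use e'x assms(2) in \<open>auto simp: k_def\<close>)
    finally show ?thesis by simp
  qed
  then show ?thesis using k unfolding product_functions_def by blast
qed

text \<open>The scalar is absorbed into one factor, which needs an index: over the empty set the
  only product is the constant \<open>\<one>\<close>.\<close>

lemma product_functions_smult:
  assumes "finite I" "I \<noteq> {}" "I \<subseteq> S" "c \<in> carrier R" "f \<in> product_functions R S B I"
  shows "(\<lambda>x. c \<otimes> f x) \<in> product_functions R S B I"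
proof -
  obtain e where e: "\<And>i. i \<in> I \<Longrightarrow> e i \<in> B i \<rightarrow> carrier R" "\<And>x. x \<in> PiE S B \<Longrightarrow> f x = (\<Otimes> i\<in>I. e i (x i))"
    using assms(5) unfolding product_functions_def by blast
  obtain i0 where i0: "i0 \<in> I" using assms by blast
  define k where "k i v = (if i = i0 then c \<otimes> e i v else e i v)" for i v
  have k: "k i \<in> B i \<rightarrow> carrier R" if "i \<in> I" for i
    using e(1)[OF that] assms(4) by (auto simp: k_def Pi_iff)
  have "c \<otimes> f x = (\<Otimes> i\<in>I. k i (x i))" if x: "x \<in> PiE S B" for x
  proof -
    have ex: "e i (x i) \<in> carrier R" if "i \<in> I" for i
      using e(1)[OF that] PiE_mem[OF x] that assms(3) by blast
    have kx: "k i (x i) \<in> carrier R" if "i \<in> I" for i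
      using k[OF that] PiE_mem[OF x] that assms(3) by blast
    have I: "finite (I - {i0})" "i0 \<notin> I - {i0}" "insert i0 (I - {i0}) = I" using i0 assms(1) by auto
    have "f x = e i0 (x i0) \<otimes> (\<Otimes> i\<in>I - {i0}. e i (x i))"
      using finprod_insert[OF I(1,2), unfolded I(3), of "\<lambda>i. e i (x i)"] ex i0 by (simp add: e(2)[OF x])
    moreover have "(\<Otimes> i\<in>I. k i (x i)) = k i0 (x i0) \<otimes> (\<Otimes> i\<in>I - {i0}. k i (x i))"
      using finprod_insert[OF I(1,2), unfolded I(3), of "\<lambda>i. k i (x i)"] kx i0 by simp
    moreover have "(\<Otimes> i\<in>I - {i0}. k i (x i)) = (\<Otimes> i\<in>I - {i0}. e i (x i))"
      using ex by (intro finprod_cong') (auto simp: k_def)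
    moreover have "(\<Otimes> i\<in>I - {i0}. e i (x i)) \<in> carrier R"
      using ex by (intro finprod_closed) auto
    ultimately show ?thesis
      using assms(4) ex i0 by (simp add: k_def m_assoc)
  qed
  then show ?thesis using k unfolding product_functions_def by blast
qed

end

text \<open>\<open>override_on z x I\<close> takes the coordinates in \<open>I\<close> from
  \<open>x\<close> and freezes the rest at \<open>z\<close>; accordingly
  \<open>t (override_on y x P)\<close> in \<open>sep\<close> is the flattening along
  \<open>P\<close> as a matrix in \<open>x\<close> and \<open>y\<close>. As \<open>z\<close> is
  arbitrary, slices of slices stay in the same family, and factorizations are required of
  \<open>t\<close> alone. The induction on \<open>card I\<close> is strong because a cut may split
  \<open>I\<close> into parts of any sizes.\<close>

lemma (in field) slice_sum_at_most:
  assumes S: "finite S" and t: "t \<in> PiE S B \<rightarrow> carrier R"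
    and sep: "\<And>i j. i \<in> S \<Longrightarrow> j \<in> S \<Longrightarrow> i \<noteq> j \<Longrightarrow>
      \<exists>P r a b. i \<in> P \<and> j \<notin> P \<and> r \<le> d \<and> a \<in> {..<r::nat} \<rightarrow> PiE S B \<rightarrow> carrier R \<and>
        b \<in> {..<r} \<rightarrow> PiE S B \<rightarrow> carrier R \<and>
        (\<forall>x \<in> PiE S B. \<forall>y \<in> PiE S B. t (override_on y x P) = (\<Oplus>s\<in>{..<r}. a s x \<otimes> b s y))"
    and I: "I \<subseteq> S" "I \<noteq> {}" and z: "z \<in> PiE S B"
  shows "sum_at_most R (PiE S B) (product_functions R S B I) (d ^ (2 * (card I - 1)))
    (\<lambda>x. t (override_on z x I))"
  using I z
proof (induction "card I" arbitrary: I z rule: less_induct)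
  case (less I z)
  let ?D = "PiE S B"
  have finI: "finite I" using less.prems S finite_subset by blast
  obtain i where i: "i \<in> I" using less.prems by blast
  show ?case
  proof (cases "I = {i}")
    case True
    \<comment> \<open>One free coordinate: the slice depends on that coordinate alone, hence is a
      single product, which matches the exponent 0.\<close>
    have "(\<lambda>x. t (override_on z x I)) \<in> product_functions R S B I"
      unfolding product_functions_def
    proof (intro CollectI exI[of _ "\<lambda>_ v. t (z(i := v))"] conjI ballI)
      have upd: "z(i := v) \<in> ?D" if "v \<in> B i" for v
        using less.prems i that by (auto simp: PiE_iff extensional_def)
      then show "(\<lambda>v. t (z(i := v))) \<in> B j \<rightarrow> carrier R" if "j \<in> I" for j
        using that t True by blast
      fix x assume x: "x \<in> ?D"
      have "override_on z x I = z(i := x i)" using True by (auto simp: override_on_def)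
      moreover have "t (z(i := x i)) \<in> carrier R"
        using upd[of "x i"] PiE_mem[OF x] i less.prems t by blast
      ultimately show "t (override_on z x I) = (\<Otimes> j\<in>I. t (z(i := x j)))"
        by (simp add: True)
    qed
    moreover have "t (override_on z x I) \<in> carrier R" if "x \<in> ?D" for x
      using override_on_PiE[OF that less.prems(3)] t by blast
    ultimately have "sum_at_most R ?D (product_functions R S B I) (Suc 0) (\<lambda>x. t (override_on z x I))"
      by (intro sum_at_most.Suc[OF _ sum_at_most.zero[of _ "\<lambda>_. \<zero>"]]) auto
    then show ?thesis using True by simp
  next
    case False
    then obtain j where j: "j \<in> I" "i \<noteq> j" using i by blast
    have ijS: "i \<in> S" "j \<in> S" using i j less.prems(1) by auto
    obtain P r a b where P: "i \<in> P" "j \<notin> P" "r \<le> d" and a: "a \<in> {..<r} \<rightarrow> ?D \<rightarrow> carrier R"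
      and b: "b \<in> {..<r} \<rightarrow> ?D \<rightarrow> carrier R"
      and ab: "\<forall>x \<in> ?D. \<forall>y \<in> ?D. t (override_on y x P) = (\<Oplus>s\<in>{..<r}. a s x \<otimes> b s y)"
      using sep[OF ijS j(2)] by (elim exE conjE) (rule that; assumption)
    define I1 I2 where "I1 = I \<inter> P" and "I2 = I - P"
    have I12: "I1 \<union> I2 = I" "I1 \<inter> I2 = {}" "I1 \<noteq> {}" "I2 \<noteq> {}" "I1 \<subseteq> S" "I2 \<subseteq> S"
      using i j P less.prems by (auto simp: I1_def I2_def)
    then have card12: "card I1 + card I2 = card I"
      using finI card_Un_disjoint[of I1 I2] by (metis finite_Un)
    have pos: "card I1 > 0" "card I2 > 0" using I12 finI by (auto simp: card_gt_0_iff)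
    \<comment> \<open>The slice with two independent arguments: \<open>x\<close> supplies the
      coordinates in \<open>I1\<close>, \<open>y\<close> those in \<open>I2\<close>. On the diagonal
      it is the slice itself.\<close>
    define A where "A x y = t (override_on z (override_on y x P) I)" for x y
    have "A x y = (\<Oplus>s\<in>{..<r}. a s (override_on z x I) \<otimes> b s (override_on z y I))"
      if "x \<in> ?D" "y \<in> ?D" for x y
    proof -
      \<comment> \<open>Overriding is pointwise, so freezing the mixed multi-index is the same as
        mixing two frozen ones; \<open>a\<close> and \<open>b\<close> are then evaluated at frozen
        arguments and the number of terms stays \<open>r\<close>.\<close>
      have "override_on z (override_on y x P) I = override_on (override_on z y I) (override_on z x I) P"
        by (auto simp: override_on_def)
      then show ?thesis
        using ab that less.prems(3) by (simp add: A_def override_on_PiE)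
    qed
    moreover have "(\<lambda>s x. a s (override_on z x I)) \<in> {..<r} \<rightarrow> ?D \<rightarrow> carrier R"
      "(\<lambda>s x. b s (override_on z x I)) \<in> {..<r} \<rightarrow> ?D \<rightarrow> carrier R"
      using a b override_on_PiE less.prems(3) by blast+
    ultimately obtain X Y where XY: "finite X" "finite Y" "X \<subseteq> ?D" "Y \<subseteq> ?D" "card X \<le> r" "card Y \<le> r"
      "(\<lambda>(x, y). A x y) \<in> lin_combs R (?D \<times> ?D) (X \<times> Y) (\<lambda>(p, q) (x, y). A x q \<otimes> A p y)"
      using cross_decomposition[of "{..<r}" "\<lambda>s x. a s (override_on z x I)" ?D
          "\<lambda>s x. b s (override_on z x I)" ?D A] by auto
    let ?n = "d ^ (2 * (card I1 - 1)) * d ^ (2 * (card I2 - 1))"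
    let ?E = "product_functions R S B"
    \<comment> \<open>The cross decomposition is restricted to the diagonal.\<close>
    have "(\<lambda>x. A x x) \<in> lin_combs R ?D (X \<times> Y) (\<lambda>(p, q) x. A x q \<otimes> A p x)"
      using XY(7) unfolding lin_combs_def by (force simp: case_prod_unfold)
    moreover have "sum_at_most R ?D (?E I) ?n (\<lambda>x. A x q \<otimes> A p x)" if "p \<in> X" "q \<in> Y" for p q
    proof -
      have pq: "override_on z p I \<in> ?D" "override_on z q I \<in> ?D"
        using that XY(3,4) less.prems(3) by (auto intro!: override_on_PiE simp: subset_iff)
      have "A x q = t (override_on (override_on z q I) x I1)" for x
        unfolding A_def by (rule arg_cong[of _ _ t]) (auto simp: override_on_def I1_def)
      moreover have "A p x = t (override_on (override_on z p I) x I2)" for x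
        unfolding A_def by (rule arg_cong[of _ _ t]) (auto simp: override_on_def I2_def)
      moreover have "sum_at_most R ?D (?E I1) (d ^ (2 * (card I1 - 1)))
          (\<lambda>x. t (override_on (override_on z q I) x I1))"
        using less.hyps[of I1] I12 card12 pos pq by simp
      moreover have "sum_at_most R ?D (?E I2) (d ^ (2 * (card I2 - 1)))
          (\<lambda>x. t (override_on (override_on z p I) x I2))"
        using less.hyps[of I2] I12 card12 pos pq by simp
      ultimately show ?thesis
        using product_functions_mult[of I1 I2 S _ B] finI I12 less.prems(1)
        by (simp only:) (intro sum_at_most_mult[of ?D "?E I1" _ _ "?E I2"] product_functions_closed; simp)
    qed
    ultimately have "sum_at_most R ?D (?E I) (card (X \<times> Y) * ?n) (\<lambda>x. A x x)"
      using XY finI less.prems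
      by (intro sum_at_most_lin_combs product_functions_closed product_functions_smult) auto
    moreover have "card (X \<times> Y) * ?n \<le> d ^ (2 * (card I - 1))"
    proof -
      \<comment> \<open>This is the only place where the rank bound enters: at most \<open>r\<close>
        rows and \<open>r\<close> columns, with \<open>r\<close> at most \<open>d\<close>.\<close>
      have "card (X \<times> Y) \<le> d ^ 2"
        using XY P(3) by (auto simp: card_cartesian_product power2_eq_square intro!: mult_le_mono)
      then have "card (X \<times> Y) * ?n \<le> d ^ 2 * ?n" by (rule mult_le_mono1)
      also have "\<dots> = d ^ (2 + (2 * (card I1 - 1) + 2 * (card I2 - 1)))"
        by (simp only: power_add)
      \<comment> \<open>Natural subtraction is exact here because both parts of \<open>I\<close> are
        nonempty.\<close>
      also have "2 + (2 * (card I1 - 1) + 2 * (card I2 - 1)) = 2 * (card I - 1)"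
        using card12 pos by linarith
      finally show ?thesis .
    qed
    moreover have "A x x = t (override_on z x I)" for x
      unfolding A_def by (rule arg_cong[of _ _ t]) (auto simp: override_on_def)
    ultimately show ?thesis using sum_at_most_mono by auto
  qed
qed

section \<open>Free modules and quotients\<close>

lemma free_space_simps:
  "f \<in> carrier (free_space K X) \<longleftrightarrow>
     (\<forall>x. f x \<in> carrier K) \<and> finite {x. f x \<noteq> \<zero>\<^bsub>K\<^esub>} \<and> {x. f x \<noteq> \<zero>\<^bsub>K\<^esub>} \<subseteq> X"
  "\<zero>\<^bsub>free_space K X\<^esub> = (\<lambda>x. \<zero>\<^bsub>K\<^esub>)"
  "f \<oplus>\<^bsub>free_space K X\<^esub> g = (\<lambda>x. f x \<oplus>\<^bsub>K\<^esub> g x)"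
  "c \<odot>\<^bsub>free_space K X\<^esub> f = (\<lambda>x. c \<otimes>\<^bsub>K\<^esub> f x)"
  by (simp_all add: free_space_def)

lemma free_spaceI:
  assumes "\<And>x. f x \<in> carrier K" "finite A" "A \<subseteq> X" "\<And>x. x \<notin> A \<Longrightarrow> f x = \<zero>\<^bsub>K\<^esub>"
  shows "f \<in> carrier (free_space K X)"
proof -
  have "{x. f x \<noteq> \<zero>\<^bsub>K\<^esub>} \<subseteq> A" using assms(4) by auto
  then show ?thesis using assms(1-3) finite_subset unfolding free_space_simps by blast
qed

lemma (in cring) free_space_module: "module R (free_space R X)"
proof -
  let ?supp = "\<lambda>f. {x. f x \<noteq> \<zero>}"
  have add: "(\<lambda>x. f x \<oplus> g x) \<in> carrier (free_space R X)"
    if "f \<in> carrier (free_space R X)" "g \<in> carrier (free_space R X)" for f g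
    using that by (intro free_spaceI[of _ _ "?supp f \<union> ?supp g"]) (auto simp: free_space_simps(1))
  have smult: "(\<lambda>x. c \<otimes> f x) \<in> carrier (free_space R X)"
    if "f \<in> carrier (free_space R X)" "c \<in> carrier R" for f c
    using that by (intro free_spaceI[of _ _ "?supp f"]) (auto simp: free_space_simps(1))
  have neg: "(\<lambda>x. \<ominus> f x) \<in> carrier (free_space R X)"
    if "f \<in> carrier (free_space R X)" for f
    using that by (intro free_spaceI[of _ _ "?supp f"]) (auto simp: free_space_simps(1))
  have c: "f x \<in> carrier R" if "f \<in> carrier (free_space R X)" for f x
    using that by (simp add: free_space_simps(1))
  show ?thesis
  proof (rule moduleI)
    show "cring R" by (rule is_cring)
    show "abelian_group (free_space R X)"
    proof (rule abelian_groupI)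
      fix f assume f: "f \<in> carrier (free_space R X)"
      show "\<exists>g\<in>carrier (free_space R X). g \<oplus>\<^bsub>free_space R X\<^esub> f = \<zero>\<^bsub>free_space R X\<^esub>"
        using neg[OF f] c[OF f] by (intro bexI[of _ "\<lambda>x. \<ominus> f x"]) (simp_all add: free_space_simps(2,3) l_neg)
    qed (simp_all add: add c a_ac free_space_simps(2,3), simp add: free_space_simps(1))
  qed (simp_all add: smult c free_space_simps(2-4) l_distr r_distr m_assoc)
qed

lemma (in cring) free_gen_closed:
  "x \<in> X \<Longrightarrow> free_gen R x \<in> carrier (free_space R X)"
  by (rule free_spaceI[of _ _ "{x}"]) (auto simp: free_gen_def)

text \<open>Induction on the finite support: one point is split off as a multiple of its
  generator.\<close>

lemma (in cring) free_space_induct [consumes 1, case_names zero gen add smult]: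
  assumes f: "f \<in> carrier (free_space R X)"
    and zero: "Q (\<lambda>x. \<zero>)"
    and gen: "\<And>x. x \<in> X \<Longrightarrow> Q (free_gen R x)"
    and add: "\<And>f g. f \<in> carrier (free_space R X) \<Longrightarrow> g \<in> carrier (free_space R X) \<Longrightarrow> Q f \<Longrightarrow> Q g
      \<Longrightarrow> Q (f \<oplus>\<^bsub>free_space R X\<^esub> g)"
    and smult: "\<And>c f. c \<in> carrier R \<Longrightarrow> f \<in> carrier (free_space R X) \<Longrightarrow> Q f
      \<Longrightarrow> Q (c \<odot>\<^bsub>free_space R X\<^esub> f)"
  shows "Q f"
proof -
  interpret F: module R "free_space R X" by (rule free_space_module)
  have "finite {x. f x \<noteq> \<zero>}" using f by (simp add: free_space_simps(1))
  then show ?thesis using f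
  proof (induction "{x. f x \<noteq> \<zero>}" arbitrary: f rule: finite_induct)
    case empty
    then have "f = (\<lambda>x. \<zero>)" by auto
    then show ?case using zero by simp
  next
    case (insert x A f)
    define g where "g = f(x := \<zero>)"
    have fc: "f y \<in> carrier R" for y using insert.prems by (simp add: free_space_simps(1))
    have x: "x \<in> X" using insert.prems insert.hyps(4) by (auto simp: free_space_simps(1))
    have A: "A = {y. g y \<noteq> \<zero>}" using insert.hyps(2,4) by (auto simp: g_def)
    have g: "g \<in> carrier (free_space R X)"
      using fc insert.hyps insert.prems A
      by (intro free_spaceI[of _ _ A]) (auto simp: g_def free_space_simps(1))
    have "f = f x \<odot>\<^bsub>free_space R X\<^esub> free_gen R x \<oplus>\<^bsub>free_space R X\<^esub> g"
      using fc by (auto simp: free_space_simps(3,4) free_gen_def g_def)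
    moreover have "Q \<dots>"
      using x fc g insert.hyps(3)[OF A g] by (intro add smult gen) (auto intro: free_gen_closed)
    ultimately show ?case by simp
  qed
qed

lemma module_hom_comp:
  assumes "f \<in> module_hom K M N" "g \<in> module_hom K N W"
  shows "(\<lambda>x. g (f x)) \<in> module_hom K M W"
  using assms by (auto simp: module_hom_def Pi_iff)

lemma (in cring) linear_extension:
  assumes W: "module R W" and m: "m \<in> X \<rightarrow> carrier W"
  obtains g where "g \<in> module_hom R (free_space R X) W" "\<And>x. x \<in> X \<Longrightarrow> g (free_gen R x) = m x"
proof -
  interpret W: module R W by (rule W)
  have mc: "m x \<in> carrier W" if "x \<in> X" for x using m that by blast
  define g where "g f = (\<Oplus>\<^bsub>W\<^esub> x\<in>{x. f x \<noteq> \<zero>}. f x \<odot>\<^bsub>W\<^esub> m x)" for f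
  \<comment> \<open>The range of summation in \<open>g_def\<close> varies with \<open>f\<close>; any
    finite set containing the support gives the same value, so sums for different functions can be
    taken over a common range.\<close>
  have g: "g f = (\<Oplus>\<^bsub>W\<^esub> x\<in>A. f x \<odot>\<^bsub>W\<^esub> m x)"
    if "f \<in> carrier (free_space R X)" "finite A" "A \<subseteq> X" "{x. f x \<noteq> \<zero>} \<subseteq> A" for f A
    unfolding g_def
    using that mc by (intro W.add.finprod_mono_neutral_cong_left) (auto simp: free_space_simps(1) subset_iff)
  have supp: "finite {x. f x \<noteq> \<zero>}" "{x. f x \<noteq> \<zero>} \<subseteq> X" "\<And>x. f x \<in> carrier R"
    if "f \<in> carrier (free_space R X)" for f
    using that by (auto simp: free_space_simps(1))
  interpret F: module R "free_space R X" by (rule free_space_module)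
  show thesis
  proof (rule that)
    have "g (f \<oplus>\<^bsub>free_space R X\<^esub> f') = g f \<oplus>\<^bsub>W\<^esub> g f'"
      if f: "f \<in> carrier (free_space R X)" "f' \<in> carrier (free_space R X)" for f f'
    proof -
      let ?A = "{x. f x \<noteq> \<zero>} \<union> {x. f' x \<noteq> \<zero>}"
      have A: "finite ?A" "?A \<subseteq> X" using supp f by auto
      have "g (f \<oplus>\<^bsub>free_space R X\<^esub> f') = (\<Oplus>\<^bsub>W\<^esub> x\<in>?A. (f x \<oplus> f' x) \<odot>\<^bsub>W\<^esub> m x)"
        unfolding free_space_simps(3)
      proof (rule g[OF F.M.a_closed[OF f, unfolded free_space_simps(3)] A])
        have "f x = \<zero> \<Longrightarrow> f' x = \<zero> \<Longrightarrow> f x \<oplus> f' x = \<zero>" for x by simp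
        then show "{x. f x \<oplus> f' x \<noteq> \<zero>} \<subseteq> ?A" by blast
      qed
      also have "\<dots> = (\<Oplus>\<^bsub>W\<^esub> x\<in>?A. f x \<odot>\<^bsub>W\<^esub> m x \<oplus>\<^bsub>W\<^esub> f' x \<odot>\<^bsub>W\<^esub> m x)"
        using A mc supp(3)[OF f(1)] supp(3)[OF f(2)]
        by (intro W.M.finsum_cong') (auto simp: W.smult_l_distr subset_iff)
      also have "\<dots> = g f \<oplus>\<^bsub>W\<^esub> g f'"
        using A mc supp(3)[OF f(1)] supp(3)[OF f(2)] g[OF f(1) A] g[OF f(2) A]
        by (simp, intro W.M.finsum_addf) (auto simp: subset_iff)
      finally show ?thesis .
    qed
    moreover have "g (c \<odot>\<^bsub>free_space R X\<^esub> f) = c \<odot>\<^bsub>W\<^esub> g f"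
      if f: "f \<in> carrier (free_space R X)" "c \<in> carrier R" for f c
    proof -
      let ?A = "{x. f x \<noteq> \<zero>}"
      have A: "finite ?A" "?A \<subseteq> X" using supp f by auto
      have "g (c \<odot>\<^bsub>free_space R X\<^esub> f) = (\<Oplus>\<^bsub>W\<^esub> x\<in>?A. (c \<otimes> f x) \<odot>\<^bsub>W\<^esub> m x)"
        unfolding free_space_simps(4)
      proof (rule g[OF F.smult_closed[OF f(2,1), unfolded free_space_simps(4)] A])
        have "f x = \<zero> \<Longrightarrow> c \<otimes> f x = \<zero>" for x using f(2) by simp
        then show "{x. c \<otimes> f x \<noteq> \<zero>} \<subseteq> ?A" by blast
      qed
      also have "\<dots> = (\<Oplus>\<^bsub>W\<^esub> x\<in>?A. c \<odot>\<^bsub>W\<^esub> (f x \<odot>\<^bsub>W\<^esub> m x))"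
        using A mc supp(3)[OF f(1)] f(2)
        by (intro W.M.finsum_cong') (auto simp: W.smult_assoc1 subset_iff)
      also have "\<dots> = c \<odot>\<^bsub>W\<^esub> g f"
        using A mc supp(3)[OF f(1)] f(2) g[OF f(1) A order_refl]
        by (simp, intro W.finsum_smult_ldistr[symmetric]) (auto simp: subset_iff)
      finally show ?thesis .
    qed
    moreover have "g f \<in> carrier W" if f: "f \<in> carrier (free_space R X)" for f
      unfolding g_def using supp[OF f] mc by (intro W.M.finsum_closed) (auto simp: subset_iff)
    ultimately show "g \<in> module_hom R (free_space R X) W"
      by (auto simp: module_hom_def)
    show "g (free_gen R x) = m x" if "x \<in> X" for x
    proof -
      have "g (free_gen R x) = (\<Oplus>\<^bsub>W\<^esub> y\<in>{x}. free_gen R x y \<odot>\<^bsub>W\<^esub> m y)"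
        using that by (intro g free_gen_closed) (auto simp: free_gen_def)
      then show ?thesis using that mc by (auto simp: free_gen_def)
    qed
  qed
qed

section \<open>Quotients by a submodule and their universal property\<close>

context module
begin

lemma submodule_abelian_subgroup:
  assumes "submodule R N M"
  shows "abelian_subgroup N M"
proof -
  interpret N: submodule R N M by (rule assms)
  have "subgroup N (add_monoid M)"
  proof (rule M.add.subgroupI)
    show "\<ominus>\<^bsub>M\<^esub> x \<in> N" if "x \<in> N" for x
    proof -
      have "(\<ominus> \<one>) \<odot>\<^bsub>M\<^esub> x \<in> N" using that by (intro N.smult_closed) auto
      then show ?thesis using that N.subset by (simp only: smult_minus_1[OF subsetD])
    qed
    show "N \<noteq> {}" using N.zero_closed by blast
  qed (use N.subset in auto)
  then show ?thesis
    by (intro abelian_subgroupI3 additive_subgroupI M.abelian_group_axioms)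
qed

lemma quotient_space_simps:
  assumes "submodule R N M"
  shows "carrier (quotient_space R M N) = (\<lambda>x. N +>\<^bsub>M\<^esub> x) ` carrier M"
    and "\<zero>\<^bsub>quotient_space R M N\<^esub> = N +>\<^bsub>M\<^esub> \<zero>\<^bsub>M\<^esub>"
    and "\<And>x y. x \<in> carrier M \<Longrightarrow> y \<in> carrier M \<Longrightarrow>
      (N +>\<^bsub>M\<^esub> x) \<oplus>\<^bsub>quotient_space R M N\<^esub> (N +>\<^bsub>M\<^esub> y) = N +>\<^bsub>M\<^esub> (x \<oplus>\<^bsub>M\<^esub> y)"
    and "\<And>c x. c \<in> carrier R \<Longrightarrow> x \<in> carrier M \<Longrightarrow>
      c \<odot>\<^bsub>quotient_space R M N\<^esub> (N +>\<^bsub>M\<^esub> x) = N +>\<^bsub>M\<^esub> (c \<odot>\<^bsub>M\<^esub> x)"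
proof -
  interpret N: submodule R N M by (rule assms)
  interpret A: abelian_subgroup N M by (rule submodule_abelian_subgroup[OF assms])
  show "carrier (quotient_space R M N) = (\<lambda>x. N +>\<^bsub>M\<^esub> x) ` carrier M"
    by (auto simp: quotient_space_def A_RCOSETS_def')
  show "\<zero>\<^bsub>quotient_space R M N\<^esub> = N +>\<^bsub>M\<^esub> \<zero>\<^bsub>M\<^esub>"
    by (simp add: quotient_space_def N.subset)
  show "(N +>\<^bsub>M\<^esub> x) \<oplus>\<^bsub>quotient_space R M N\<^esub> (N +>\<^bsub>M\<^esub> y) = N +>\<^bsub>M\<^esub> (x \<oplus>\<^bsub>M\<^esub> y)"
    if "x \<in> carrier M" "y \<in> carrier M" for x y
    using that by (simp add: quotient_space_def A.a_rcos_sum)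
  show "c \<odot>\<^bsub>quotient_space R M N\<^esub> (N +>\<^bsub>M\<^esub> x) = N +>\<^bsub>M\<^esub> (c \<odot>\<^bsub>M\<^esub> x)"
    if c: "c \<in> carrier R" and x: "x \<in> carrier M" for c x
  proof -
    \<comment> \<open>The scalar multiple of a coset is a union over its representatives. These
      differ by elements of \<open>N\<close>, hence so do their multiples, and all cosets in the
      union coincide.\<close>
    have eq: "N +>\<^bsub>M\<^esub> (c \<odot>\<^bsub>M\<^esub> a) = N +>\<^bsub>M\<^esub> (c \<odot>\<^bsub>M\<^esub> x)" if a: "a \<in> N +>\<^bsub>M\<^esub> x" for a
    proof -
      have ac: "a \<in> carrier M" using A.a_elemrcos_carrier[OF x a] .
      have "a \<oplus>\<^bsub>M\<^esub> \<ominus>\<^bsub>M\<^esub> x \<in> N" using A.a_rcos_module_imp[OF x a] .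
      then have "c \<odot>\<^bsub>M\<^esub> (a \<oplus>\<^bsub>M\<^esub> \<ominus>\<^bsub>M\<^esub> x) \<in> N" using c by blast
      then have "c \<odot>\<^bsub>M\<^esub> a \<oplus>\<^bsub>M\<^esub> \<ominus>\<^bsub>M\<^esub> (c \<odot>\<^bsub>M\<^esub> x) \<in> N"
        using c x ac by (simp add: smult_r_distr smult_r_minus)
      then have "c \<odot>\<^bsub>M\<^esub> a \<in> N +>\<^bsub>M\<^esub> (c \<odot>\<^bsub>M\<^esub> x)"
        using c x ac by (intro A.a_rcos_module_rev) auto
      then show ?thesis
        using A.a_repr_independence'[of "c \<odot>\<^bsub>M\<^esub> a" "c \<odot>\<^bsub>M\<^esub> x"] c x by simp
    qed
    have "x \<in> N +>\<^bsub>M\<^esub> x" using x by (rule A.a_rcos_self)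
    then have "(\<Union>a \<in> N +>\<^bsub>M\<^esub> x. N +>\<^bsub>M\<^esub> (c \<odot>\<^bsub>M\<^esub> a)) = N +>\<^bsub>M\<^esub> (c \<odot>\<^bsub>M\<^esub> x)"
      using eq by blast
    then show ?thesis by (simp add: quotient_space_def)
  qed
qed

lemma quotient_space_module:
  assumes N: "submodule R N M"
  shows "module R (quotient_space R M N)"
proof (rule moduleI)
  note simps = quotient_space_simps[OF N]
  show "abelian_group (quotient_space R M N)"
  proof (rule abelian_groupI)
    fix A assume "A \<in> carrier (quotient_space R M N)"
    then obtain x where x: "A = N +>\<^bsub>M\<^esub> x" "x \<in> carrier M" by (auto simp: simps(1))
    show "\<exists>B\<in>carrier (quotient_space R M N). B \<oplus>\<^bsub>quotient_space R M N\<^esub> A = \<zero>\<^bsub>quotient_space R M N\<^esub>"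
      using x by (intro bexI[of _ "N +>\<^bsub>M\<^esub> (\<ominus>\<^bsub>M\<^esub> x)"]) (auto simp: simps M.l_neg)
  qed (auto simp: simps M.a_ac)
qed (auto simp: quotient_space_simps[OF N] R.is_cring smult_l_distr smult_r_distr smult_assoc1)

lemma quotient_space_universal:
  assumes N: "submodule R N M" and W: "module R W"
    and g: "g \<in> module_hom R M W" "\<And>x. x \<in> N \<Longrightarrow> g x = \<zero>\<^bsub>W\<^esub>"
  obtains \<phi> where "\<phi> \<in> module_hom R (quotient_space R M N) W"
    "\<And>x. x \<in> carrier M \<Longrightarrow> \<phi> (N +>\<^bsub>M\<^esub> x) = g x"
proof -
  interpret A: abelian_subgroup N M by (rule submodule_abelian_subgroup[OF N])
  interpret W: module R W by (rule W)
  interpret g: mod_hom R M W g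
    by (intro mod_hom.intro mod_hom_axioms.intro module_axioms W g(1))
  \<comment> \<open>Any representative will do: \<open>g\<close> kills \<open>N\<close> and is
    therefore constant on each coset.\<close>
  define \<phi> where "\<phi> A = g (SOME x. x \<in> A)" for A
  have \<phi>: "\<phi> (N +>\<^bsub>M\<^esub> x) = g x" if x: "x \<in> carrier M" for x
  proof -
    have "g y = g x" if y: "y \<in> N +>\<^bsub>M\<^esub> x" for y
    proof -
      have yc: "y \<in> carrier M" using A.a_elemrcos_carrier[OF x y] .
      have "g (y \<oplus>\<^bsub>M\<^esub> \<ominus>\<^bsub>M\<^esub> x) = \<zero>\<^bsub>W\<^esub>" using g(2) A.a_rcos_module_imp[OF x y] .
      then have "g y \<oplus>\<^bsub>W\<^esub> \<ominus>\<^bsub>W\<^esub> g x = \<zero>\<^bsub>W\<^esub>" using x yc by simp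
      then show ?thesis using x yc by (metis W.M.minus_equality W.M.minus_minus g.f_im W.M.a_inv_closed)
    qed
    moreover have "x \<in> N +>\<^bsub>M\<^esub> x" using x by (rule A.a_rcos_self)
    ultimately show ?thesis unfolding \<phi>_def by (metis someI)
  qed
  show thesis
  proof (rule that[OF _ \<phi>])
    show "\<phi> \<in> module_hom R (quotient_space R M N) W"
      by (auto simp: module_hom_def quotient_space_simps[OF N] \<phi>)
  qed
qed

end

section \<open>Universal property of the tensor product\<close>

definition multilinear ::
  "('a, 'm) ring_scheme \<Rightarrow> 'i set \<Rightarrow> ('i \<Rightarrow> ('a, 'v, 'n) module_scheme) \<Rightarrow> ('a, 'w, 'p) module_scheme
     \<Rightarrow> (('i \<Rightarrow> 'v) \<Rightarrow> 'w) \<Rightarrow> bool" where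
  "multilinear K S V W m \<longleftrightarrow> m \<in> tuples S V \<rightarrow> carrier W \<and>
     (\<forall>u\<in>tuples S V. \<forall>i\<in>S. \<forall>x\<in>carrier (V i). \<forall>y\<in>carrier (V i).
        m (u(i := x \<oplus>\<^bsub>V i\<^esub> y)) = m (u(i := x)) \<oplus>\<^bsub>W\<^esub> m (u(i := y))) \<and>
     (\<forall>u\<in>tuples S V. \<forall>i\<in>S. \<forall>c\<in>carrier K. \<forall>x\<in>carrier (V i).
        m (u(i := c \<odot>\<^bsub>V i\<^esub> x)) = c \<odot>\<^bsub>W\<^esub> m (u(i := x)))"

lemma tuples_upd:
  "u \<in> tuples S V \<Longrightarrow> i \<in> S \<Longrightarrow> x \<in> carrier (V i) \<Longrightarrow> u(i := x) \<in> tuples S V"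
  by (auto simp: tuples_def PiE_iff extensional_def)

text \<open>\<open>S\<close> is arbitrary because the locale serves three kinds of products: over
  all indices, over one block of a partition, and over the set of blocks, where the factors are
  tensor products themselves.\<close>

locale tensor = cring K for K (structure) +
  fixes S :: "'i set" and V :: "'i \<Rightarrow> ('a, 'v, 'n) module_scheme"
  assumes module_factor: "i \<in> S \<Longrightarrow> module K (V i)"
begin

abbreviation "F \<equiv> free_space K (tuples S V)"
abbreviation "N \<equiv> relation_space K S V"
abbreviation "TP \<equiv> tensor_product K S V"
abbreviation "pure \<equiv> pure_tensor K S V"

lemma F_module: "module K F"
  by (rule free_space_module)

lemma add_factor_closed: "i \<in> S \<Longrightarrow> x \<in> carrier (V i) \<Longrightarrow> y \<in> carrier (V i) \<Longrightarrow> x \<oplus>\<^bsub>V i\<^esub> y \<in> carrier (V i)"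
proof -
  assume "i \<in> S" "x \<in> carrier (V i)" "y \<in> carrier (V i)"
  then interpret V: module K "V i" by (intro module_factor)
  show ?thesis using \<open>x \<in> _\<close> \<open>y \<in> _\<close> by simp
qed

lemma smult_factor_closed: "i \<in> S \<Longrightarrow> c \<in> carrier K \<Longrightarrow> x \<in> carrier (V i) \<Longrightarrow> c \<odot>\<^bsub>V i\<^esub> x \<in> carrier (V i)"
proof -
  assume "i \<in> S" "c \<in> carrier K" "x \<in> carrier (V i)"
  then interpret V: module K "V i" by (intro module_factor)
  show ?thesis using \<open>x \<in> _\<close> \<open>c \<in> _\<close> by simp
qed

lemma free_gen_F: "u \<in> tuples S V \<Longrightarrow> free_gen K u \<in> carrier F"
  by (rule free_gen_closed)

lemma relations_closed: "multilinear_relations K S V \<subseteq> carrier F"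
proof -
  interpret F: module K F by (rule F_module)
  show ?thesis
    unfolding multilinear_relations_def Let_def
    by (auto intro!: F.minus_closed F.M.a_closed F.smult_closed free_gen_F tuples_upd
        add_factor_closed smult_factor_closed)
qed

lemma relation_submodule: "submodule K N F"
  unfolding relation_space_def
  by (rule module.span_is_submodule[OF F_module relations_closed])

lemma TP_module: "module K TP"
  unfolding tensor_product_def
  by (rule module.quotient_space_module[OF F_module relation_submodule])

lemma pure_closed: "u \<in> tuples S V \<Longrightarrow> pure u \<in> carrier TP"
  unfolding tensor_product_def pure_tensor_def
  by (simp add: module.quotient_space_simps[OF F_module relation_submodule] free_gen_F)

text \<open>Multilinearity of \<open>m\<close> says that its linear extension to the free space
  kills the defining relations; then it kills their span and descends to the quotient.\<close>

lemma TP_universal: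
  assumes W: "module K W" and m: "multilinear K S V W m"
  obtains \<phi> where "\<phi> \<in> module_hom K TP W" "\<And>u. u \<in> tuples S V \<Longrightarrow> \<phi> (pure u) = m u"
proof -
  interpret F: module K F by (rule F_module)
  interpret W: module K W by (rule W)
  have mc: "m \<in> tuples S V \<rightarrow> carrier W" using m by (simp add: multilinear_def)
  obtain g where g: "g \<in> module_hom K F W" "\<And>u. u \<in> tuples S V \<Longrightarrow> g (free_gen K u) = m u"
    using linear_extension[OF W mc] by blast
  interpret g: mod_hom K F W g
    by (intro mod_hom.intro mod_hom_axioms.intro F_module W g(1))
  have "multilinear_relations K S V \<subseteq> g.ker"
  proof
    fix r assume r: "r \<in> multilinear_relations K S V"
    then have rF: "r \<in> carrier F" using relations_closed by auto
    from r have "g r = \<zero>\<^bsub>W\<^esub>"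
      unfolding multilinear_relations_def Let_def
    proof (elim UnE CollectE exE conjE)
      fix u i x y
      assume r: "r = free_gen K (u(i := x \<oplus>\<^bsub>V i\<^esub> y)) \<ominus>\<^bsub>F\<^esub> (free_gen K (u(i := x)) \<oplus>\<^bsub>F\<^esub> free_gen K (u(i := y)))"
        and u: "u \<in> tuples S V" "i \<in> S" and xy: "x \<in> carrier (V i)" "y \<in> carrier (V i)"
      have "m (u(i := x \<oplus>\<^bsub>V i\<^esub> y)) = m (u(i := x)) \<oplus>\<^bsub>W\<^esub> m (u(i := y))"
        using m u xy by (simp add: multilinear_def)
      moreover have "u(i := x) \<in> tuples S V" "u(i := y) \<in> tuples S V" "u(i := x \<oplus>\<^bsub>V i\<^esub> y) \<in> tuples S V"
        using u xy by (auto intro!: tuples_upd add_factor_closed)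
      moreover from this have "m (u(i := x)) \<in> carrier W" "m (u(i := y)) \<in> carrier W" using mc by blast+
      ultimately show "g r = \<zero>\<^bsub>W\<^esub>"
        by (simp add: r free_gen_F g(2) W.M.minus_eq W.M.r_neg)
    next
      fix u i c x
      assume r: "r = free_gen K (u(i := c \<odot>\<^bsub>V i\<^esub> x)) \<ominus>\<^bsub>F\<^esub> (c \<odot>\<^bsub>F\<^esub> free_gen K (u(i := x)))"
        and u: "u \<in> tuples S V" "i \<in> S" and cx: "c \<in> carrier K" "x \<in> carrier (V i)"
      have "m (u(i := c \<odot>\<^bsub>V i\<^esub> x)) = c \<odot>\<^bsub>W\<^esub> m (u(i := x))"
        using m u cx by (simp add: multilinear_def)
      moreover have "u(i := x) \<in> tuples S V" "u(i := c \<odot>\<^bsub>V i\<^esub> x) \<in> tuples S V"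
        using u cx by (auto intro!: tuples_upd smult_factor_closed)
      moreover from this have "m (u(i := x)) \<in> carrier W" using mc by blast+
      ultimately show "g r = \<zero>\<^bsub>W\<^esub>"
        using cx by (simp add: r free_gen_F g(2) W.M.minus_eq W.M.r_neg)
    qed
    then show "r \<in> g.ker" using rF by (simp add: g.ker_def)
  qed
  then have "N \<subseteq> g.ker"
    unfolding relation_space_def by (rule F.span_is_subset[OF _ g.ker_is_submodule])
  then have "g x = \<zero>\<^bsub>W\<^esub>" if "x \<in> N" for x using that by (auto simp: g.ker_def)
  then obtain \<phi> where \<phi>: "\<phi> \<in> module_hom K TP W" "\<And>x. x \<in> carrier F \<Longrightarrow> \<phi> (N +>\<^bsub>F\<^esub> x) = g x"
    using F.quotient_space_universal[OF relation_submodule W g(1)]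
    unfolding tensor_product_def by blast
  show thesis
    by (rule that[OF \<phi>(1)]) (simp add: pure_tensor_def \<phi>(2) free_gen_F g(2))
qed

lemma TP_induct [consumes 1, case_names zero pure add smult]:
  assumes T: "T \<in> carrier TP"
    and zero: "Q \<zero>\<^bsub>TP\<^esub>"
    and pure: "\<And>u. u \<in> tuples S V \<Longrightarrow> Q (pure u)"
    and add: "\<And>A B. A \<in> carrier TP \<Longrightarrow> B \<in> carrier TP \<Longrightarrow> Q A \<Longrightarrow> Q B \<Longrightarrow> Q (A \<oplus>\<^bsub>TP\<^esub> B)"
    and smult: "\<And>c A. c \<in> carrier K \<Longrightarrow> A \<in> carrier TP \<Longrightarrow> Q A \<Longrightarrow> Q (c \<odot>\<^bsub>TP\<^esub> A)"
  shows "Q T"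
proof -
  note simps = module.quotient_space_simps[OF F_module relation_submodule, folded tensor_product_def]
  obtain f where f: "T = N +>\<^bsub>F\<^esub> f" "f \<in> carrier F" using T by (auto simp: simps(1))
  have coset: "N +>\<^bsub>F\<^esub> f \<in> carrier TP" if "f \<in> carrier F" for f using that by (simp add: simps(1))
  from f(2) have "Q (N +>\<^bsub>F\<^esub> f)"
  proof (induction rule: free_space_induct)
    case zero
    then show ?case using assms(2) by (simp add: simps(2) free_space_simps(2))
  next
    case (gen u)
    then show ?case using assms(3) by (simp add: pure_tensor_def)
  next
    case (add f g)
    then show ?case using assms(4)[of "N +>\<^bsub>F\<^esub> f" "N +>\<^bsub>F\<^esub> g"] coset by (simp add: simps(3))
  next
    case (smult c f)
    then show ?case using assms(5)[of c "N +>\<^bsub>F\<^esub> f"] coset by (simp add: simps(4))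
  qed
  then show ?thesis using f(1) by simp
qed

text \<open>The two sides of each law differ by a defining relation, so they represent the same
  coset.\<close>

lemma pure_multilinear: "multilinear K S V TP pure"
proof -
  interpret F: module K F by (rule F_module)
  interpret A: abelian_subgroup N F by (rule F.submodule_abelian_subgroup[OF relation_submodule])
  note simps = F.quotient_space_simps[OF relation_submodule, folded tensor_product_def]
  have rel: "N +>\<^bsub>F\<^esub> f = N +>\<^bsub>F\<^esub> g"
    if "f \<ominus>\<^bsub>F\<^esub> g \<in> multilinear_relations K S V" "f \<in> carrier F" "g \<in> carrier F" for f g
  proof -
    have "f \<oplus>\<^bsub>F\<^esub> \<ominus>\<^bsub>F\<^esub> g \<in> N"
      using F.in_own_span[OF relations_closed] that(1)
      unfolding relation_space_def by (auto simp: F.M.minus_eq)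
    then have "f \<in> N +>\<^bsub>F\<^esub> g" using that by (intro A.a_rcos_module_rev) auto
    then show ?thesis using A.a_repr_independence' that(3) by metis
  qed
  show ?thesis
    unfolding multilinear_def
  proof (intro conjI ballI Pi_I pure_closed)
    fix u i x y
    assume u: "u \<in> tuples S V" "i \<in> S" and xy: "x \<in> carrier (V i)" "y \<in> carrier (V i)"
    have c: "free_gen K (u(i := x)) \<in> carrier F" "free_gen K (u(i := y)) \<in> carrier F"
      "free_gen K (u(i := x \<oplus>\<^bsub>V i\<^esub> y)) \<in> carrier F"
      using u xy by (auto intro!: free_gen_F tuples_upd add_factor_closed)
    have "free_gen K (u(i := x \<oplus>\<^bsub>V i\<^esub> y)) \<ominus>\<^bsub>F\<^esub> (free_gen K (u(i := x)) \<oplus>\<^bsub>F\<^esub> free_gen K (u(i := y)))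
        \<in> multilinear_relations K S V"
      using u xy unfolding multilinear_relations_def Let_def by blast
    from rel[OF this c(3) F.M.a_closed[OF c(1,2)]]
    show "pure (u(i := x \<oplus>\<^bsub>V i\<^esub> y)) = pure (u(i := x)) \<oplus>\<^bsub>TP\<^esub> pure (u(i := y))"
      using c by (simp add: pure_tensor_def simps(3))
  next
    fix u i c x
    assume u: "u \<in> tuples S V" "i \<in> S" and cx: "c \<in> carrier K" "x \<in> carrier (V i)"
    have c: "free_gen K (u(i := x)) \<in> carrier F" "free_gen K (u(i := c \<odot>\<^bsub>V i\<^esub> x)) \<in> carrier F"
      using u cx by (auto intro!: free_gen_F tuples_upd smult_factor_closed)
    have "free_gen K (u(i := c \<odot>\<^bsub>V i\<^esub> x)) \<ominus>\<^bsub>F\<^esub> (c \<odot>\<^bsub>F\<^esub> free_gen K (u(i := x)))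
        \<in> multilinear_relations K S V"
      using u cx unfolding multilinear_relations_def Let_def by blast
    from rel[OF this c(2) F.smult_closed[OF cx(1) c(1)]]
    show "pure (u(i := c \<odot>\<^bsub>V i\<^esub> x)) = c \<odot>\<^bsub>TP\<^esub> pure (u(i := x))"
      using c cx by (simp add: pure_tensor_def simps(4))
  qed
qed

lemma pure_add:
  "u \<in> tuples S V \<Longrightarrow> i \<in> S \<Longrightarrow> x \<in> carrier (V i) \<Longrightarrow> y \<in> carrier (V i) \<Longrightarrow>
    pure (u(i := x \<oplus>\<^bsub>V i\<^esub> y)) = pure (u(i := x)) \<oplus>\<^bsub>TP\<^esub> pure (u(i := y))"
  using pure_multilinear unfolding multilinear_def by simp

lemma pure_smult:
  "u \<in> tuples S V \<Longrightarrow> i \<in> S \<Longrightarrow> c \<in> carrier K \<Longrightarrow> x \<in> carrier (V i) \<Longrightarrow>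
    pure (u(i := c \<odot>\<^bsub>V i\<^esub> x)) = c \<odot>\<^bsub>TP\<^esub> pure (u(i := x))"
  using pure_multilinear unfolding multilinear_def by simp

end

section \<open>Linear forms and sums of pure tensors\<close>

text \<open>The scalars as a module over themselves, so that linear forms are module homomorphisms
  and \<open>TP_universal\<close> applies to scalar-valued multilinear maps.\<close>

definition ring_module :: "('a, 'm) ring_scheme \<Rightarrow> ('a, 'a) module" where
  "ring_module K = \<lparr>carrier = carrier K, mult = mult K, one = one K, zero = zero K, add = add K,
     smult = mult K\<rparr>"

lemma ring_module_simps [simp]:
  "carrier (ring_module K) = carrier K" "\<zero>\<^bsub>ring_module K\<^esub> = \<zero>\<^bsub>K\<^esub>"
  "x \<oplus>\<^bsub>ring_module K\<^esub> y = x \<oplus>\<^bsub>K\<^esub> y" "c \<odot>\<^bsub>ring_module K\<^esub> x = c \<otimes>\<^bsub>K\<^esub> x"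
  by (simp_all add: ring_module_def)

lemma (in cring) ring_module_module: "module R (ring_module R)"
proof (rule moduleI)
  show "abelian_group (ring_module R)"
    by (rule abelian_groupI) (auto simp: a_ac intro!: bexI[of _ "\<ominus> _"] l_neg)
qed (auto simp: is_cring l_distr r_distr m_assoc)

lemma finsum_ring_module [simp]: "finsum (ring_module K) f A = finsum K f A"
  by (simp add: finsum_def finprod_def ring_module_def)

lemma (in mod_hom) hom_finsum:
  "g \<in> A \<rightarrow> carrier M \<Longrightarrow> f (\<Oplus>\<^bsub>M\<^esub> a\<in>A. g a) = (\<Oplus>\<^bsub>N\<^esub> a\<in>A. f (g a))"
proof (induction A rule: infinite_finite_induct)
  case (insert a A)
  then have "(\<Oplus>\<^bsub>N\<^esub> a\<in>insert a A. f (g a)) = f (g a) \<oplus>\<^bsub>N\<^esub> (\<Oplus>\<^bsub>N\<^esub> a\<in>A. f (g a))"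
    by (intro N.M.finsum_insert) auto
  with insert show ?case by simp
qed auto

abbreviation linear_forms :: "('a, 'm) ring_scheme \<Rightarrow> ('a, 'v, 'n) module_scheme \<Rightarrow> ('v \<Rightarrow> 'a) set" where
  "linear_forms K M \<equiv> module_hom K M (ring_module K)"

text \<open>The condition that \<open>tensor_rank\<close> minimises. The minimum is attained once
  some number of terms qualifies, which \<open>pure_sum_exists\<close> guarantees over a nonempty
  index set.\<close>

definition pure_sum ::
  "('a, 'm) ring_scheme \<Rightarrow> 'i set \<Rightarrow> ('i \<Rightarrow> ('a, 'v, 'n) module_scheme) \<Rightarrow> nat
     \<Rightarrow> (('i \<Rightarrow> 'v) \<Rightarrow> 'a) set \<Rightarrow> bool" where
  "pure_sum K S V r T \<longleftrightarrow> (\<exists>v. (\<forall>s<r. v s \<in> tuples S V) \<and>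
     T = (\<Oplus>\<^bsub>tensor_product K S V\<^esub> s\<in>{..<r}. pure_tensor K S V (v s)))"

lemma tensor_rank_le: "pure_sum K S V r T \<Longrightarrow> tensor_rank K S V T \<le> r"
  unfolding tensor_rank_def pure_sum_def by (rule Least_le)

lemma pure_sum_tensor_rank: "pure_sum K S V r T \<Longrightarrow> pure_sum K S V (tensor_rank K S V T) T"
  unfolding tensor_rank_def pure_sum_def by (rule LeastI)

context tensor
begin

lemma form_closed: "\<phi> \<in> linear_forms K M \<Longrightarrow> x \<in> carrier M \<Longrightarrow> \<phi> x \<in> carrier K"
  by (auto dest!: module_hom_closed)

text \<open>Changing the entry at \<open>i\<close> changes a single factor of the product, so
  multilinearity reduces to linearity of \<open>l i\<close>.\<close>

lemma product_form:
  assumes S: "finite S" and l: "\<And>i. i \<in> S \<Longrightarrow> l i \<in> linear_forms K (V i)"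
  shows "\<exists>\<phi>. \<phi> \<in> linear_forms K TP \<and> (\<forall>u\<in>tuples S V. \<phi> (pure u) = (\<Otimes>i\<in>S. l i (u i)))"
proof -
  have lc: "l i x \<in> carrier K" if "i \<in> S" "x \<in> carrier (V i)" for i x
    using form_closed[OF l] that .
  have uc: "u i \<in> carrier (V i)" if "u \<in> tuples S V" "i \<in> S" for u i
    using that by (auto simp: tuples_def)
  have upd: "(\<Otimes>j\<in>S. l j ((u(i := x)) j)) = l i x \<otimes> (\<Otimes>j\<in>S - {i}. l j (u j))"
    if "u \<in> tuples S V" "i \<in> S" "x \<in> carrier (V i)" for u i x
  proof -
    have "(\<Otimes>j\<in>insert i (S - {i}). l j ((u(i := x)) j))
        = l i x \<otimes> (\<Otimes>j\<in>S - {i}. l j ((u(i := x)) j))"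
      using S lc uc that by (subst finprod_insert) auto
    also have "(\<Otimes>j\<in>S - {i}. l j ((u(i := x)) j)) = (\<Otimes>j\<in>S - {i}. l j (u j))"
      using lc uc that by (intro finprod_cong') auto
    finally show ?thesis using that by (simp add: insert_absorb)
  qed
  have rest: "(\<Otimes>j\<in>S - {i}. l j (u j)) \<in> carrier K" if "u \<in> tuples S V" for u i
    using lc uc that by (intro finprod_closed) auto
  have "multilinear K S V (ring_module K) (\<lambda>u. \<Otimes>i\<in>S. l i (u i))"
    unfolding multilinear_def
  proof (intro conjI ballI Pi_I, unfold ring_module_simps)
    show "(\<Otimes>i\<in>S. l i (u i)) \<in> carrier K" if "u \<in> tuples S V" for u
      using lc uc that by (intro finprod_closed) auto
  next
    fix u i x y
    assume u: "u \<in> tuples S V" "i \<in> S" and xy: "x \<in> carrier (V i)" "y \<in> carrier (V i)"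
    have "l i (x \<oplus>\<^bsub>V i\<^esub> y) = l i x \<oplus> l i y"
      using module_hom_add[OF l[OF u(2)] xy] by simp
    then show "(\<Otimes>j\<in>S. l j ((u(i := x \<oplus>\<^bsub>V i\<^esub> y)) j)) =
        (\<Otimes>j\<in>S. l j ((u(i := x)) j)) \<oplus> (\<Otimes>j\<in>S. l j ((u(i := y)) j))"
      using upd[OF u] xy add_factor_closed[OF u(2) xy] lc[OF u(2)] rest[OF u(1)]
      by (simp only: l_distr)
  next
    fix u i c x
    assume u: "u \<in> tuples S V" "i \<in> S" and cx: "c \<in> carrier K" "x \<in> carrier (V i)"
    have "l i (c \<odot>\<^bsub>V i\<^esub> x) = c \<otimes> l i x"
      using module_hom_smult[OF l[OF u(2)] cx] by simp
    then show "(\<Otimes>j\<in>S. l j ((u(i := c \<odot>\<^bsub>V i\<^esub> x)) j)) = c \<otimes> (\<Otimes>j\<in>S. l j ((u(i := x)) j))"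
      using upd[OF u] cx smult_factor_closed[OF u(2) cx] lc[OF u(2)] rest[OF u(1)]
      by (simp only: m_assoc)
  qed
  from TP_universal[OF ring_module_module this] show ?thesis by metis
qed

lemma hom_eqI:
  assumes "module K W" "\<phi> \<in> module_hom K TP W" "\<psi> \<in> module_hom K TP W"
    and "\<And>u. u \<in> tuples S V \<Longrightarrow> \<phi> (pure u) = \<psi> (pure u)"
    and "T \<in> carrier TP"
  shows "\<phi> T = \<psi> T"
proof -
  interpret \<phi>: mod_hom K TP W \<phi>
    by (intro mod_hom.intro mod_hom_axioms.intro TP_module assms(1,2))
  interpret \<psi>: mod_hom K TP W \<psi>
    by (intro mod_hom.intro mod_hom_axioms.intro TP_module assms(1,3))
  show ?thesis
    using assms(5) by (induction rule: TP_induct) (simp_all add: assms(4))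
qed

section \<open>Sums of a given number of pure tensors\<close>

lemma pure_sum_0: "pure_sum K S V 0 \<zero>\<^bsub>TP\<^esub>"
proof -
  interpret TP: module K TP by (rule TP_module)
  show ?thesis by (simp add: pure_sum_def)
qed

lemma pure_sum_Suc:
  assumes "u \<in> tuples S V" "pure_sum K S V r T"
  shows "pure_sum K S V (Suc r) (pure u \<oplus>\<^bsub>TP\<^esub> T)"
proof -
  interpret TP: module K TP by (rule TP_module)
  obtain v where v: "\<And>s. s < r \<Longrightarrow> v s \<in> tuples S V" "T = (\<Oplus>\<^bsub>TP\<^esub> s\<in>{..<r}. pure (v s))"
    using assms(2) by (auto simp: pure_sum_def)
  have "(\<Oplus>\<^bsub>TP\<^esub> s\<in>{..<Suc r}. pure ((v(r := u)) s)) = pure u \<oplus>\<^bsub>TP\<^esub> (\<Oplus>\<^bsub>TP\<^esub> s\<in>{..<r}. pure ((v(r := u)) s))"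
    unfolding lessThan_Suc using assms(1) v(1) by (subst TP.M.finsum_insert) (auto simp: pure_closed)
  also have "(\<Oplus>\<^bsub>TP\<^esub> s\<in>{..<r}. pure ((v(r := u)) s)) = T"
    unfolding v(2) using v(1) by (intro TP.M.finsum_cong') (auto simp: pure_closed)
  finally have "pure u \<oplus>\<^bsub>TP\<^esub> T = (\<Oplus>\<^bsub>TP\<^esub> s\<in>{..<Suc r}. pure ((v(r := u)) s))" ..
  then show ?thesis
    unfolding pure_sum_def using assms(1) v(1) by (intro exI[of _ "v(r := u)"]) (simp add: less_Suc_eq)
qed

lemma pure_sum_SucE:
  assumes "pure_sum K S V (Suc r) T"
  obtains u A where "u \<in> tuples S V" "pure_sum K S V r A" "A \<in> carrier TP" "T = pure u \<oplus>\<^bsub>TP\<^esub> A"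
proof -
  interpret TP: module K TP by (rule TP_module)
  obtain v where v: "\<And>s. s < Suc r \<Longrightarrow> v s \<in> tuples S V" "T = (\<Oplus>\<^bsub>TP\<^esub> s\<in>{..<Suc r}. pure (v s))"
    using assms by (auto simp: pure_sum_def)
  show thesis
  proof (rule that)
    show "pure_sum K S V r (\<Oplus>\<^bsub>TP\<^esub> s\<in>{..<r}. pure (v s))"
      unfolding pure_sum_def using v(1) by (intro exI[of _ v]) simp
    show "(\<Oplus>\<^bsub>TP\<^esub> s\<in>{..<r}. pure (v s)) \<in> carrier TP"
      using v(1) by (auto intro!: TP.M.finsum_closed pure_closed)
    show "T = pure (v r) \<oplus>\<^bsub>TP\<^esub> (\<Oplus>\<^bsub>TP\<^esub> s\<in>{..<r}. pure (v s))"
      unfolding v(2) lessThan_Suc using v(1) by (subst TP.M.finsum_insert) (auto simp: pure_closed)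
  qed (use v(1) in simp)
qed

lemma pure_sum_closed: "pure_sum K S V r T \<Longrightarrow> T \<in> carrier TP"
proof -
  interpret TP: module K TP by (rule TP_module)
  show "pure_sum K S V r T \<Longrightarrow> T \<in> carrier TP"
    by (auto simp: pure_sum_def intro!: TP.M.finsum_closed pure_closed)
qed

lemma pure_sum_add:
  assumes "pure_sum K S V r A" "pure_sum K S V s B"
  shows "pure_sum K S V (r + s) (A \<oplus>\<^bsub>TP\<^esub> B)"
  using assms(1)
proof (induction r arbitrary: A)
  interpret TP: module K TP by (rule TP_module)
  {
    case 0
    then have "A = \<zero>\<^bsub>TP\<^esub>" by (auto simp: pure_sum_def)
    then show ?case using assms(2) pure_sum_closed[OF assms(2)] by simp
  next
    case (Suc r)
    then obtain u A' where u: "u \<in> tuples S V" "pure_sum K S V r A'" "A' \<in> carrier TP" "A = pure u \<oplus>\<^bsub>TP\<^esub> A'"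
      by (elim pure_sum_SucE)
    then have "pure_sum K S V (Suc (r + s)) (pure u \<oplus>\<^bsub>TP\<^esub> (A' \<oplus>\<^bsub>TP\<^esub> B))"
      by (intro pure_sum_Suc Suc.IH)
    then show ?case
      using u pure_closed[OF u(1)] pure_sum_closed[OF assms(2)] by (simp add: TP.M.a_assoc)
  }
qed

text \<open>Scalars have to be absorbed into an entry of each tuple, which needs an index: over the
  empty index set there is one pure tensor, and sums give only its natural multiples.\<close>

lemma pure_sum_exists:
  assumes "S \<noteq> {}" "T \<in> carrier TP"
  shows "\<exists>r. pure_sum K S V r T"
  using assms(2)
proof (induction rule: TP_induct)
  interpret TP: module K TP by (rule TP_module)
  obtain i where i: "i \<in> S" using assms(1) by blast
  {
    case zero
    then show ?case using pure_sum_0 by blast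
  next
    case (pure u)
    then have "pure_sum K S V (Suc 0) (pure_tensor K S V u \<oplus>\<^bsub>TP\<^esub> \<zero>\<^bsub>TP\<^esub>)"
      by (intro pure_sum_Suc pure_sum_0)
    then show ?case using pure pure_closed by auto
  next
    case (add A B)
    then show ?case using pure_sum_add by blast
  next
    case (smult c A)
    then obtain r where "pure_sum K S V r A" by blast
    then have "pure_sum K S V r (c \<odot>\<^bsub>TP\<^esub> A)"
    proof (induction r arbitrary: A)
      case 0
      then have "A = \<zero>\<^bsub>TP\<^esub>" by (auto simp: pure_sum_def)
      then show ?case using pure_sum_0 smult(1) by simp
    next
      case (Suc r)
      then obtain u A' where u: "u \<in> tuples S V" "pure_sum K S V r A'" "A' \<in> carrier TP" "A = pure u \<oplus>\<^bsub>TP\<^esub> A'"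
        by (elim pure_sum_SucE)
      have ui: "u i \<in> carrier (V i)" using u(1) i by (auto simp: tuples_def)
      have "pure (u(i := c \<odot>\<^bsub>V i\<^esub> u i)) = c \<odot>\<^bsub>TP\<^esub> pure (u(i := u i))"
        by (intro pure_smult u i smult(1) ui)
      moreover have "u(i := c \<odot>\<^bsub>V i\<^esub> u i) \<in> tuples S V"
        by (intro tuples_upd u i smult_factor_closed smult(1) ui)
      ultimately have "pure_sum K S V (Suc r) (c \<odot>\<^bsub>TP\<^esub> pure u \<oplus>\<^bsub>TP\<^esub> c \<odot>\<^bsub>TP\<^esub> A')"
        using pure_sum_Suc[OF _ Suc.IH[OF u(2)]] by (metis fun_upd_triv)
      then show ?case
        using u smult(1) pure_closed[OF u(1)] by (simp add: TP.smult_r_distr)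
    qed
    then show ?case by blast
  }
qed

end

section \<open>Coordinates\<close>

text \<open>\<open>c b\<close> is the coefficient of \<open>b\<close> in the expansion of a vector;
  it is linear because expansions are unique. Generation is phrased through submodules
  \<open>Z\<close>, ready for showing that a linear condition true on \<open>B\<close> is true
  everywhere.\<close>

lemma (in vectorspace) finite_dual_basis:
  assumes "fin_dim"
  shows "\<exists>B c. finite B \<and> B \<subseteq> carrier V \<and> (\<forall>b\<in>B. c b \<in> linear_forms K V) \<and>
    (\<forall>b\<in>B. \<forall>b'\<in>B. c b b' = (if b' = b then \<one>\<^bsub>K\<^esub> else \<zero>\<^bsub>K\<^esub>)) \<and>
    (\<forall>Z. submodule K Z V \<longrightarrow> B \<subseteq> Z \<longrightarrow> carrier V \<subseteq> Z)"
proof -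
  obtain B where B: "finite B" "basis B" using finite_basis_exists[OF assms] by blast
  have BV: "B \<subseteq> carrier V" and gen: "span B = carrier V" using B(2) by (auto simp: basis_def)
  have ex: "\<exists>!a. a \<in> B \<rightarrow>\<^sub>E carrier K \<and> lincomb a B = v" if "v \<in> carrier V" for v
    using basis_criterion[OF B(1) BV] B(2) that by blast
  define coeff where "coeff v = (THE a. a \<in> B \<rightarrow>\<^sub>E carrier K \<and> lincomb a B = v)" for v
  have coeff: "coeff v \<in> B \<rightarrow>\<^sub>E carrier K" "lincomb (coeff v) B = v" if "v \<in> carrier V" for v
    using theI'[OF ex[OF that]] by (simp_all add: coeff_def)
  have coeff': "coeff v \<in> B \<rightarrow> carrier K" if "v \<in> carrier V" for v
    using coeff(1)[OF that] by auto
  \<comment> \<open>Uniqueness of coefficients holds among functions extensional on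
    \<open>B\<close>; restriction makes it available for arbitrary ones.\<close>
  have restr: "lincomb (restrict a B) B = lincomb a B" if "a \<in> B \<rightarrow> carrier K" for a
    unfolding lincomb_def using that BV by (intro M.finsum_cong') (auto simp: Pi_iff subset_iff)
  have unique: "coeff v b = a b" if "b \<in> B" "a \<in> B \<rightarrow> carrier K" "lincomb a B = v" for a b v
  proof -
    have v: "v \<in> carrier V" using that BV B(1) by auto
    have "restrict a B = coeff v"
      using ex[OF v] coeff[OF v] restr[OF that(2)] that(2,3) by (metis restrict_PiE_iff Pi_mem)
    then show ?thesis using that(1) by (metis restrict_apply')
  qed
  have "(\<lambda>v. coeff v b) \<in> linear_forms K V" if b: "b \<in> B" for b
    unfolding module_hom_def
  proof (intro CollectI conjI allI impI Pi_I; (elim conjE)?; unfold ring_module_simps)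
    show "coeff v b \<in> carrier K" if "v \<in> carrier V" for v
      using coeff'[OF that] b by blast
  next
    fix v w assume v: "v \<in> carrier V" and w: "w \<in> carrier V"
    show "coeff (v \<oplus>\<^bsub>V\<^esub> w) b = coeff v b \<oplus>\<^bsub>K\<^esub> coeff w b"
    proof (rule unique[OF b])
      show "(\<lambda>b. coeff v b \<oplus>\<^bsub>K\<^esub> coeff w b) \<in> B \<rightarrow> carrier K"
        using coeff'[OF v] coeff'[OF w] by (simp add: Pi_iff)
      show "lincomb (\<lambda>b. coeff v b \<oplus>\<^bsub>K\<^esub> coeff w b) B = v \<oplus>\<^bsub>V\<^esub> w"
        using lincomb_sum[OF B(1) BV coeff'[OF v] coeff'[OF w]] coeff(2)[OF v] coeff(2)[OF w] by simp
    qed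
  next
    fix r v assume r: "r \<in> carrier K" and v: "v \<in> carrier V"
    show "coeff (r \<odot>\<^bsub>V\<^esub> v) b = r \<otimes>\<^bsub>K\<^esub> coeff v b"
    proof (rule unique[OF b])
      show "(\<lambda>b. r \<otimes>\<^bsub>K\<^esub> coeff v b) \<in> B \<rightarrow> carrier K"
        using coeff'[OF v] r by (simp add: Pi_iff)
      show "lincomb (\<lambda>b. r \<otimes>\<^bsub>K\<^esub> coeff v b) B = r \<odot>\<^bsub>V\<^esub> v"
        using lincomb_smult[OF BV coeff'[OF v] r] coeff(2)[OF v] by simp
    qed
  qed
  moreover have "coeff b' b = (if b' = b then \<one>\<^bsub>K\<^esub> else \<zero>\<^bsub>K\<^esub>)" if b: "b \<in> B" "b' \<in> B" for b b'
  proof (rule unique[OF b(1)])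
    have "lincomb (\<lambda>b. if b' = b then \<one>\<^bsub>K\<^esub> else \<zero>\<^bsub>K\<^esub>) B = (\<Oplus>\<^bsub>V\<^esub> b\<in>B. if b' = b then b else \<zero>\<^bsub>V\<^esub>)"
      unfolding lincomb_def using BV by (intro M.finsum_cong') (auto simp: subset_iff)
    also have "\<dots> = b'"
      using BV b B(1) by (intro M.finsum_singleton) auto
    finally show "lincomb (\<lambda>b. if b' = b then \<one>\<^bsub>K\<^esub> else \<zero>\<^bsub>K\<^esub>) B = b'" .
  qed auto
  moreover have "carrier V \<subseteq> Z" if "submodule K Z V" "B \<subseteq> Z" for Z
    using span_is_subset[OF that(2,1)] gen by simp
  ultimately show ?thesis
    using B(1) BV by (intro exI[of _ B] exI[of _ "\<lambda>b v. coeff v b"]) simp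
qed

text \<open>A basis \<open>B i\<close> of each factor together with its coordinate forms
  \<open>c i b\<close>. The data pass to every subset of \<open>S\<close>, so the blocks of a
  partition get coordinates from the same choice.\<close>

locale tensor_basis = tensor K S V
  for K :: "('a, 'm) ring_scheme" (structure) and S :: "'i set" and V :: "'i \<Rightarrow> ('a, 'v, 'n) module_scheme" +
  fixes B :: "'i \<Rightarrow> 'v set" and c :: "'i \<Rightarrow> 'v \<Rightarrow> 'v \<Rightarrow> 'a"
  assumes finite_S: "finite S"
    and finite_B: "i \<in> S \<Longrightarrow> finite (B i)"
    and B_closed: "i \<in> S \<Longrightarrow> B i \<subseteq> carrier (V i)"
    and c_form: "i \<in> S \<Longrightarrow> b \<in> B i \<Longrightarrow> c i b \<in> linear_forms K (V i)"
    and c_dual: "i \<in> S \<Longrightarrow> b \<in> B i \<Longrightarrow> b' \<in> B i \<Longrightarrow> c i b b' = (if b' = b then \<one> else \<zero>)"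
    and B_gen: "i \<in> S \<Longrightarrow> submodule K Z (V i) \<Longrightarrow> B i \<subseteq> Z \<Longrightarrow> carrier (V i) \<subseteq> Z"
begin

abbreviation "D \<equiv> PiE S B"

text \<open>The coefficient of a tensor at the multi-index \<open>b\<close>. On the carrier the
  choice is unique, since pure tensors generate; existence is \<open>product_form\<close>.\<close>

definition coord :: "('i \<Rightarrow> 'v) \<Rightarrow> (('i \<Rightarrow> 'v) \<Rightarrow> 'a) set \<Rightarrow> 'a" where
  "coord b = (SOME \<phi>. \<phi> \<in> linear_forms K TP \<and>
     (\<forall>u\<in>tuples S V. \<phi> (pure u) = (\<Otimes>i\<in>S. c i (b i) (u i))))"

lemma coord:
  assumes "b \<in> D"
  shows "coord b \<in> linear_forms K TP"
    and "u \<in> tuples S V \<Longrightarrow> coord b (pure u) = (\<Otimes>i\<in>S. c i (b i) (u i))"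
proof -
  have "\<And>i. i \<in> S \<Longrightarrow> c i (b i) \<in> linear_forms K (V i)"
    using assms by (intro c_form) auto
  from someI_ex[OF product_form[OF finite_S this]]
  show "coord b \<in> linear_forms K TP"
    "u \<in> tuples S V \<Longrightarrow> coord b (pure u) = (\<Otimes>i\<in>S. c i (b i) (u i))"
    unfolding coord_def by blast+
qed

lemma finite_D: "finite D"
  by (intro finite_PiE finite_S finite_B)

lemma D_tuples: "D \<subseteq> tuples S V"
  unfolding tuples_def by (intro PiE_mono B_closed)

lemma coord_closed: "b \<in> D \<Longrightarrow> T \<in> carrier TP \<Longrightarrow> coord b T \<in> carrier K"
  using form_closed[OF coord(1)] .

lemma coord_hom: "b \<in> D \<Longrightarrow> mod_hom K TP (ring_module K) (coord b)"
  by (intro mod_hom.intro mod_hom_axioms.intro TP_module ring_module_module coord(1))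

lemma coord_pure_basis:
  assumes "b \<in> D" "b' \<in> D"
  shows "coord b (pure b') = (if b' = b then \<one> else \<zero>)"
proof -
  have eq: "coord b (pure b') = (\<Otimes>i\<in>S. if b' i = b i then \<one> else \<zero>)"
    unfolding coord(2)[OF assms(1) subsetD[OF D_tuples assms(2)]]
    using assms by (intro finprod_cong') (auto simp: c_dual PiE_mem)
  show ?thesis
  proof (cases "b' = b")
    case True
    then show ?thesis unfolding eq by simp
  next
    case False
    then obtain i where "i \<in> S" "b' i \<noteq> b i" using PiE_ext[OF assms(2,1)] by blast
    then show ?thesis
      unfolding eq using False finite_S by (subst finprod_zero) auto
  qed
qed

text \<open>The tensors equal to their own expansion form a submodule, so pure tensors suffice. For
  a pure tensor of basis vectors the expansion is a Kronecker delta; from there the entries are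
  released one at a time.\<close>

lemma expansion:
  assumes "T \<in> carrier TP"
  shows "T = (\<Oplus>\<^bsub>TP\<^esub> b\<in>D. coord b T \<odot>\<^bsub>TP\<^esub> pure b)"
proof -
  interpret TP: module K TP by (rule TP_module)
  have pure_D: "pure b \<in> carrier TP" if "b \<in> D" for b
    using that D_tuples pure_closed by blast
  define Z where "Z = {T \<in> carrier TP. T = (\<Oplus>\<^bsub>TP\<^esub> b\<in>D. coord b T \<odot>\<^bsub>TP\<^esub> pure b)}"
  have Z_sub: "Z \<subseteq> carrier TP" by (auto simp: Z_def)
  have Z_eq: "(\<Oplus>\<^bsub>TP\<^esub> b\<in>D. coord b A \<odot>\<^bsub>TP\<^esub> pure b) = A" if "A \<in> Z" for A
    using that unfolding Z_def by (elim CollectE conjE) (erule sym)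
  have Z_zero: "\<zero>\<^bsub>TP\<^esub> \<in> Z"
  proof -
    have "(\<Oplus>\<^bsub>TP\<^esub> b\<in>D. coord b \<zero>\<^bsub>TP\<^esub> \<odot>\<^bsub>TP\<^esub> pure b) = (\<Oplus>\<^bsub>TP\<^esub> b\<in>D. \<zero>\<^bsub>TP\<^esub>)"
      using mod_hom.f0_is_0[OF coord_hom] pure_D by (intro TP.M.finsum_cong') auto
    then show ?thesis by (simp add: Z_def)
  qed
  have Z_add: "A \<oplus>\<^bsub>TP\<^esub> A' \<in> Z" if A: "A \<in> Z" "A' \<in> Z" for A A'
  proof -
    have AC: "A \<in> carrier TP" "A' \<in> carrier TP" using that Z_sub by auto
    have "(\<Oplus>\<^bsub>TP\<^esub> b\<in>D. coord b (A \<oplus>\<^bsub>TP\<^esub> A') \<odot>\<^bsub>TP\<^esub> pure b)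
        = (\<Oplus>\<^bsub>TP\<^esub> b\<in>D. coord b A \<odot>\<^bsub>TP\<^esub> pure b \<oplus>\<^bsub>TP\<^esub> coord b A' \<odot>\<^bsub>TP\<^esub> pure b)"
      using module_hom_add[OF coord(1) AC] AC pure_D coord_closed
      by (intro TP.M.finsum_cong') (auto simp: TP.smult_l_distr)
    also have "\<dots> = (\<Oplus>\<^bsub>TP\<^esub> b\<in>D. coord b A \<odot>\<^bsub>TP\<^esub> pure b) \<oplus>\<^bsub>TP\<^esub> (\<Oplus>\<^bsub>TP\<^esub> b\<in>D. coord b A' \<odot>\<^bsub>TP\<^esub> pure b)"
      using AC pure_D coord_closed by (intro TP.M.finsum_addf) auto
    also have "\<dots> = A \<oplus>\<^bsub>TP\<^esub> A'" using A by (simp only: Z_eq)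
    finally show ?thesis using AC by (simp add: Z_def)
  qed
  have Z_smult: "r \<odot>\<^bsub>TP\<^esub> A \<in> Z" if A: "A \<in> Z" and r: "r \<in> carrier K" for A r
  proof -
    have AC: "A \<in> carrier TP" using that Z_sub by auto
    have "(\<Oplus>\<^bsub>TP\<^esub> b\<in>D. coord b (r \<odot>\<^bsub>TP\<^esub> A) \<odot>\<^bsub>TP\<^esub> pure b)
        = (\<Oplus>\<^bsub>TP\<^esub> b\<in>D. r \<odot>\<^bsub>TP\<^esub> (coord b A \<odot>\<^bsub>TP\<^esub> pure b))"
      using module_hom_smult[OF coord(1) r AC] AC r pure_D coord_closed
      by (intro TP.M.finsum_cong') (auto simp: TP.smult_assoc1)
    also have "\<dots> = r \<odot>\<^bsub>TP\<^esub> (\<Oplus>\<^bsub>TP\<^esub> b\<in>D. coord b A \<odot>\<^bsub>TP\<^esub> pure b)"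
      using AC r pure_D coord_closed finite_D by (intro TP.finsum_smult_ldistr[symmetric]) auto
    also have "\<dots> = r \<odot>\<^bsub>TP\<^esub> A" using A by (simp only: Z_eq)
    finally show ?thesis using AC r by (simp add: Z_def)
  qed
  \<comment> \<open>\<open>J\<close> is the set of positions whose entry is not yet known to be a basis vector\<close>
  have "pure u \<in> Z" if "J \<subseteq> S" "u \<in> tuples S V" "\<And>i. i \<in> S - J \<Longrightarrow> u i \<in> B i" for J u
    using finite_subset[OF that(1) finite_S] that
  proof (induction J arbitrary: u)
    case empty
    then have u: "u \<in> D" by (auto simp: tuples_def PiE_iff)
    have "(\<Oplus>\<^bsub>TP\<^esub> b\<in>D. coord b (pure u) \<odot>\<^bsub>TP\<^esub> pure b) = (\<Oplus>\<^bsub>TP\<^esub> b\<in>D. if u = b then pure b else \<zero>\<^bsub>TP\<^esub>)"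
      using u pure_D by (intro TP.M.finsum_cong') (auto simp: coord_pure_basis)
    also have "\<dots> = pure u"
      using u pure_D finite_D by (intro TP.M.finsum_singleton) auto
    finally show ?case using pure_D[OF u] by (simp add: Z_def)
  next
    case (insert j J u)
    have j: "j \<in> S" using insert.prems by auto
    interpret Vj: module K "V j" by (rule module_factor[OF j])
    have upd: "u(j := x) \<in> tuples S V" if "x \<in> carrier (V j)" for x
      using tuples_upd[OF insert.prems(2) j that] .
    \<comment> \<open>The vectors that may stand at position \<open>j\<close> form a submodule, and
      by induction it contains \<open>B j\<close>; hence every vector may stand there.\<close>
    define Y where "Y = {x \<in> carrier (V j). pure (u(j := x)) \<in> Z}"
    have "submodule K Y (V j)"
    proof (rule submodule.intro)
      show "module K (V j)" by (rule module_factor[OF j])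
      show "Y \<subseteq> carrier (V j)" by (auto simp: Y_def)
      show "v \<oplus>\<^bsub>V j\<^esub> w \<in> Y" if "v \<in> Y" "w \<in> Y" for v w
      proof -
        have "pure (u(j := v \<oplus>\<^bsub>V j\<^esub> w)) = pure (u(j := v)) \<oplus>\<^bsub>TP\<^esub> pure (u(j := w))"
          using that by (intro pure_add insert.prems(2) j) (auto simp: Y_def)
        then show ?thesis using that Z_add by (simp add: Y_def)
      qed
      show smult: "r \<odot>\<^bsub>V j\<^esub> v \<in> Y" if "r \<in> carrier K" "v \<in> Y" for r v
      proof -
        have "pure (u(j := r \<odot>\<^bsub>V j\<^esub> v)) = r \<odot>\<^bsub>TP\<^esub> pure (u(j := v))"
          using that by (intro pure_smult insert.prems(2) j) (auto simp: Y_def)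
        then show ?thesis using that Z_smult by (simp add: Y_def)
      qed
      \<comment> \<open>A pure tensor with a zero entry is zero: the entry is written as zero times
        itself and the scalar is pulled out.\<close>
      have zero: "pure (u(j := \<zero> \<odot>\<^bsub>V j\<^esub> \<zero>\<^bsub>V j\<^esub>)) = \<zero> \<odot>\<^bsub>TP\<^esub> pure (u(j := \<zero>\<^bsub>V j\<^esub>))"
        by (intro pure_smult insert.prems(2) j Vj.M.zero_closed zero_closed)
      then show "\<zero>\<^bsub>V j\<^esub> \<in> Y"
        using Z_zero pure_closed[OF upd[of "\<zero>\<^bsub>V j\<^esub>"]] by (simp add: Y_def)
    qed
    moreover have "B j \<subseteq> Y"
    proof
      fix x assume x: "x \<in> B j"
      then have "x \<in> carrier (V j)" using B_closed[OF j] by auto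
      moreover have "pure (u(j := x)) \<in> Z"
      proof (rule insert.IH)
        show "J \<subseteq> S" using insert.prems by auto
        show "u(j := x) \<in> tuples S V" using upd[OF \<open>x \<in> carrier (V j)\<close>] .
        show "(u(j := x)) i \<in> B i" if "i \<in> S - J" for i
          using that x insert.prems(3) by (cases "i = j") auto
      qed
      ultimately show "x \<in> Y" by (simp add: Y_def)
    qed
    moreover have "u j \<in> carrier (V j)" using insert.prems(2) j by (auto simp: tuples_def)
    ultimately have "u j \<in> Y" using B_gen[OF j] by blast
    then show ?case by (simp add: Y_def)
  qed
  then have Z_pure: "pure u \<in> Z" if "u \<in> tuples S V" for u using that by blast
  from assms have "T \<in> Z"
    by (induction rule: TP_induct) (auto intro: Z_zero Z_add Z_smult Z_pure)
  then show ?thesis by (simp add: Z_def)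
qed

lemma coord_inject:
  assumes "T \<in> carrier TP" "T' \<in> carrier TP" "\<And>b. b \<in> D \<Longrightarrow> coord b T = coord b T'"
  shows "T = T'"
proof -
  interpret TP: module K TP by (rule TP_module)
  have "(\<Oplus>\<^bsub>TP\<^esub> b\<in>D. coord b T \<odot>\<^bsub>TP\<^esub> pure b) = (\<Oplus>\<^bsub>TP\<^esub> b\<in>D. coord b T' \<odot>\<^bsub>TP\<^esub> pure b)"
    using assms coord_closed pure_closed D_tuples by (intro TP.M.finsum_cong') auto
  then show ?thesis using expansion[OF assms(1)] expansion[OF assms(2)] by simp
qed

text \<open>A product function is the coordinate function of a pure tensor: its factor at
  \<open>i\<close> lists the coordinates of the \<open>i\<close>-th entry. The zero function is
  realised by the empty sum, hence \<open>r\<close> may fall below \<open>n\<close>.\<close>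

lemma pure_sum_of_sum_at_most:
  assumes "sum_at_most K D (product_functions K S B S) n f"
  shows "\<exists>r\<le>n. \<exists>T. pure_sum K S V r T \<and> (\<forall>b\<in>D. coord b T = f b)"
  using assms
proof (induction)
  case (zero f n)
  then show ?case
    using pure_sum_0 mod_hom.f0_is_0[OF coord_hom] by (intro exI[of _ 0]) auto
next
  case (Suc e n g f)
  obtain r T where r: "r \<le> n" "pure_sum K S V r T" "\<And>b. b \<in> D \<Longrightarrow> coord b T = g b"
    using Suc(4) by blast
  obtain e' where e': "\<And>i. i \<in> S \<Longrightarrow> e' i \<in> B i \<rightarrow> carrier K" "\<And>x. x \<in> D \<Longrightarrow> e x = (\<Otimes> i\<in>S. e' i (x i))"
    using Suc(1) unfolding product_functions_def by blast
  define u where "u = (\<lambda>i\<in>S. \<Oplus>\<^bsub>V i\<^esub> b\<in>B i. e' i b \<odot>\<^bsub>V i\<^esub> b)"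
  have ui: "u i \<in> carrier (V i)" and cu: "\<And>b. b \<in> B i \<Longrightarrow> c i b (u i) = e' i b" if i: "i \<in> S" for i
  proof -
    interpret Vi: module K "V i" by (rule module_factor[OF i])
    have e'c: "e' i b \<in> carrier K" if "b \<in> B i" for b using e'(1)[OF i] that by blast
    have Bc: "b \<in> carrier (V i)" if "b \<in> B i" for b using B_closed[OF i] that by blast
    show "u i \<in> carrier (V i)"
      using i e'c Bc by (auto simp: u_def intro!: Vi.M.finsum_closed)
    fix b assume b: "b \<in> B i"
    interpret h: mod_hom K "V i" "ring_module K" "c i b"
      by (intro mod_hom.intro mod_hom_axioms.intro module_factor[OF i] ring_module_module c_form i b)
    have "c i b (u i) = (\<Oplus> b'\<in>B i. c i b (e' i b' \<odot>\<^bsub>V i\<^esub> b'))"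
      using h.hom_finsum[of "\<lambda>b'. e' i b' \<odot>\<^bsub>V i\<^esub> b'" "B i"] i e'c Bc by (simp add: u_def Pi_iff)
    also have "\<dots> = (\<Oplus> b'\<in>B i. if b = b' then e' i b' else \<zero>)"
      using i b e'c Bc by (intro finsum_cong') (auto simp: c_dual)
    also have "\<dots> = e' i b"
      using b e'c finite_B[OF i] by (intro finsum_singleton) auto
    finally show "c i b (u i) = e' i b" .
  qed
  have u: "u \<in> tuples S V" using ui by (auto simp: tuples_def u_def)
  have Tc: "T \<in> carrier TP" using pure_sum_closed r(2) .
  have "coord b (pure u \<oplus>\<^bsub>TP\<^esub> T) = f b" if b: "b \<in> D" for b
  proof -
    have "coord b (pure u) = (\<Otimes>i\<in>S. c i (b i) (u i))" using coord(2)[OF b u] .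
    also have "\<dots> = e b"
      unfolding e'(2)[OF b] using b cu e'(1) by (intro finprod_cong') (auto simp: PiE_mem Pi_iff)
    finally show ?thesis
      using module_hom_add[OF coord(1)[OF b] pure_closed[OF u] Tc] r(3)[OF b] Suc(3)[OF b] by simp
  qed
  moreover have "pure_sum K S V (Suc r) (pure u \<oplus>\<^bsub>TP\<^esub> T)"
    using pure_sum_Suc[OF u r(2)] .
  ultimately show ?case using r(1) by (intro exI[of _ "Suc r"]) auto
qed

lemma tensor_rank_le_sum_at_most:
  assumes "T \<in> carrier TP" "sum_at_most K D (product_functions K S B S) n (\<lambda>b. coord b T)"
  shows "tensor_rank K S V T \<le> n"
proof -
  obtain r T' where r: "r \<le> n" "pure_sum K S V r T'" "\<And>b. b \<in> D \<Longrightarrow> coord b T' = coord b T"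
    using pure_sum_of_sum_at_most[OF assms(2)] by blast
  then have "T' = T" using coord_inject pure_sum_closed assms(1) by metis
  then show ?thesis using tensor_rank_le[OF r(2)] r(1) by simp
qed

end

section \<open>Flattenings\<close>

lemma (in tensor) restrict_tuples: "v \<in> tuples S V \<Longrightarrow> A \<subseteq> S \<Longrightarrow> restrict v A \<in> tuples A V"
  by (auto simp: tuples_def PiE_iff)

lemma (in tensor) tensor_subset: "A \<subseteq> S \<Longrightarrow> tensor K A V"
  by (intro tensor.intro tensor_axioms.intro cring_axioms) (rule module_factor, blast)

lemma (in tensor) tensor_blocks:
  assumes "\<Union>P \<subseteq> S"
  shows "tensor K P (block_products K V)"
proof (intro tensor.intro tensor_axioms.intro cring_axioms)
  fix A assume "A \<in> P"
  then interpret A: tensor K A V using assms by (intro tensor_subset) auto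
  show "module K (block_products K V A)"
    unfolding block_products_def by (rule A.TP_module)
qed

text \<open>The map is picked by \<open>SOME\<close>, so a map with both properties has to be
  exhibited. The universal property supplies it: each index lies in exactly one block, so changing
  one entry of \<open>v\<close> changes one entry of the tuple of blockwise pure tensors.\<close>

lemma (in tensor) flattening_map_spec:
  assumes P: "partition_on S P"
  shows "flattening_map K S V P \<in> module_hom K TP (tensor_product K P (block_products K V))"
    and "v \<in> tuples S V \<Longrightarrow> flattening_map K S V P (pure v) =
      pure_tensor K P (block_products K V) (\<lambda>A\<in>P. pure_tensor K A V (restrict v A))"
proof -
  have US: "\<Union>P = S" using P by (simp add: partition_on_def)
  interpret P: tensor K P "block_products K V" by (rule tensor_blocks) (simp add: US)
  define w where "w v = (\<lambda>A\<in>P. pure_tensor K A V (restrict v A))" for v :: "'i \<Rightarrow> 'v"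
  have A: "tensor K A V" if "A \<in> P" for A using that US by (intro tensor_subset) auto
  have w: "w v \<in> tuples P (block_products K V)" if v: "v \<in> tuples S V" for v
    unfolding w_def tuples_def
  proof (rule restrict_PiE_iff[THEN iffD2], rule ballI)
    fix A' assume A': "A' \<in> P"
    interpret A: tensor K A' V by (rule A[OF A'])
    show "pure_tensor K A' V (restrict v A') \<in> carrier (block_products K V A')"
      unfolding block_products_def using A' US v by (intro A.pure_closed restrict_tuples) auto
  qed
  have upd: "w (v(i := x)) = (w v)(A' := pure_tensor K A' V ((restrict v A')(i := x)))"
    if "i \<in> A'" "A' \<in> P" for v i x A'
  proof
    fix A'' show "w (v(i := x)) A'' = ((w v)(A' := pure_tensor K A' V ((restrict v A')(i := x)))) A''"
    proof (cases "A'' = A'")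
      case True
      moreover have "restrict (v(i := x)) A' = (restrict v A')(i := x)" using that by auto
      ultimately show ?thesis using that by (simp add: w_def)
    next
      case False
      have "restrict (v(i := x)) A'' = restrict v A''" if "A'' \<in> P"
      proof -
        have "i \<notin> A''"
          using P that \<open>i \<in> A'\<close> \<open>A' \<in> P\<close> False by (auto simp: partition_on_def disjoint_def)
        then show ?thesis by auto
      qed
      then show ?thesis using False by (simp add: w_def)
    qed
  qed
  have "multilinear K S V P.TP (\<lambda>v. P.pure (w v))"
    unfolding multilinear_def
  proof (intro conjI ballI Pi_I)
    show "P.pure (w v) \<in> carrier P.TP" if "v \<in> tuples S V" for v
      using P.pure_closed[OF w[OF that]] .
  next
    fix v i x y
    assume v: "v \<in> tuples S V" "i \<in> S" and xy: "x \<in> carrier (V i)" "y \<in> carrier (V i)"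
    obtain A' where A': "A' \<in> P" "i \<in> A'" using US v by auto
    interpret A: tensor K A' V by (rule A[OF A'(1)])
    have vA: "restrict v A' \<in> tuples A' V" using v A' US by (intro restrict_tuples) auto
    have "A.pure ((restrict v A')(i := x)) \<in> carrier (block_products K V A')"
      "A.pure ((restrict v A')(i := y)) \<in> carrier (block_products K V A')"
      unfolding block_products_def using vA A' xy by (auto intro!: A.pure_closed tuples_upd)
    from P.pure_add[OF w[OF v(1)] A'(1) this]
    show "P.pure (w (v(i := x \<oplus>\<^bsub>V i\<^esub> y))) = P.pure (w (v(i := x))) \<oplus>\<^bsub>P.TP\<^esub> P.pure (w (v(i := y)))"
      using A.pure_add[OF vA A'(2) xy] by (simp add: upd[OF A'(2,1)] block_products_def)
  next
    fix v i r x
    assume v: "v \<in> tuples S V" "i \<in> S" and rx: "r \<in> carrier K" "x \<in> carrier (V i)"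
    obtain A' where A': "A' \<in> P" "i \<in> A'" using US v by auto
    interpret A: tensor K A' V by (rule A[OF A'(1)])
    have vA: "restrict v A' \<in> tuples A' V" using v A' US by (intro restrict_tuples) auto
    have "A.pure ((restrict v A')(i := x)) \<in> carrier (block_products K V A')"
      unfolding block_products_def using vA A' rx by (auto intro!: A.pure_closed tuples_upd)
    from P.pure_smult[OF w[OF v(1)] A'(1) rx(1) this]
    show "P.pure (w (v(i := r \<odot>\<^bsub>V i\<^esub> x))) = r \<odot>\<^bsub>P.TP\<^esub> P.pure (w (v(i := x)))"
      using A.pure_smult[OF vA A'(2) rx] by (simp add: upd[OF A'(2,1)] block_products_def)
  qed
  from TP_universal[OF P.TP_module this]
  have "\<exists>\<phi>. \<phi> \<in> module_hom K TP P.TP \<and> (\<forall>v\<in>tuples S V. \<phi> (pure v) = P.pure (w v))"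
    by metis
  from someI_ex[OF this]
  show "flattening_map K S V P \<in> module_hom K TP P.TP"
    "v \<in> tuples S V \<Longrightarrow> flattening_map K S V P (pure v) =
      P.pure (\<lambda>A\<in>P. pure_tensor K A V (restrict v A))"
    unfolding flattening_map_def w_def by blast+
qed

section \<open>Flattenings in coordinates\<close>

lemma (in tensor_basis) tensor_basis_subset:
  assumes A: "A \<subseteq> S"
  shows "tensor_basis K A V B c"
proof (intro tensor_basis.intro tensor_basis_axioms.intro tensor_subset A)
  show "finite A" using A finite_S by (rule finite_subset)
  fix i b b' Z assume "i \<in> A"
  then have i: "i \<in> S" using A by blast
  show "finite (B i)" "B i \<subseteq> carrier (V i)" using i by (rule finite_B B_closed)+
  show "c i b \<in> linear_forms K (V i)" if "b \<in> B i" using i that by (rule c_form)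
  show "c i b b' = (if b' = b then \<one> else \<zero>)" if "b \<in> B i" "b' \<in> B i"
    using i that by (rule c_dual)
  show "carrier (V i) \<subseteq> Z" if "submodule K Z (V i)" "B i \<subseteq> Z" using i that by (rule B_gen)
qed

text \<open>A minimal decomposition of the flattening consists of pure tensors with one entry for
  \<open>I\<close> and one for \<open>J\<close>. Evaluated by the product of the two blockwise
  coordinate forms, each term becomes a factor depending on the \<open>I\<close>-coordinates times
  one depending on the \<open>J\<close>-coordinates.\<close>

lemma (in tensor_basis) coord_flattening:
  assumes P: "partition_on S {I, J}" "I \<noteq> J" and T: "T \<in> carrier TP"
  shows "\<exists>a b. a \<in> {..<flattening_rank K S V {I, J} T} \<rightarrow> D \<rightarrow> carrier K \<and>
    b \<in> {..<flattening_rank K S V {I, J} T} \<rightarrow> D \<rightarrow> carrier K \<and>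
    (\<forall>x\<in>D. \<forall>y\<in>D. coord (override_on y x I) T =
      (\<Oplus>s\<in>{..<flattening_rank K S V {I, J} T}. a s x \<otimes> b s y))"
proof -
  let ?P = "{I, J}"
  have IJ: "I \<union> J = S" "I \<inter> J = {}" "I \<subseteq> S" "J \<subseteq> S"
    using P by (auto simp: partition_on_def disjoint_def)
  interpret P: tensor K ?P "block_products K V" by (rule tensor_blocks) (use IJ in auto)
  note \<phi> = flattening_map_spec[OF P(1)]
  let ?\<phi> = "flattening_map K S V ?P"
  let ?r = "flattening_rank K S V ?P T"
  have "?\<phi> T \<in> carrier P.TP" using module_hom_closed[OF \<phi>(1)] T by blast
  from P.pure_sum_exists[OF _ this] have "pure_sum K ?P (block_products K V) ?r (?\<phi> T)"
    unfolding flattening_rank_def by (auto intro: pure_sum_tensor_rank)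
  then obtain w where w: "\<And>s. s < ?r \<Longrightarrow> w s \<in> tuples ?P (block_products K V)"
    "?\<phi> T = (\<Oplus>\<^bsub>P.TP\<^esub> s\<in>{..<?r}. P.pure (w s))"
    by (auto simp: pure_sum_def)
  \<comment> \<open>The coordinate form on the block \<open>A\<close>; it sees \<open>x\<close> only
    through its restriction to \<open>A\<close>.\<close>
  define l where "l x A = tensor_basis.coord K A V c (restrict x A)" for x A
  have sub: "A \<subseteq> S" if "A \<in> ?P" for A using that IJ by auto
  have basis: "tensor_basis K A V B c" if "A \<in> ?P" for A using sub[OF that] by (rule tensor_basis_subset)
  have restr: "restrict x A \<in> PiE A B" if "A \<in> ?P" "x \<in> D" for x A
    using sub[OF that(1)] that(2) by (auto simp: PiE_iff)
  have l: "l x A \<in> linear_forms K (block_products K V A)" if "A \<in> ?P" "x \<in> D" for x A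
    unfolding l_def block_products_def by (rule tensor_basis.coord(1)[OF basis restr]) fact+
  have l_pure: "l x A (pure_tensor K A V (restrict v A)) = (\<Otimes>i\<in>A. c i (x i) (v i))"
    if "A \<in> ?P" "x \<in> D" "v \<in> tuples S V" for x A v
  proof -
    have cc: "c i (x i) (v i) \<in> carrier K" if "i \<in> A" for i
      using that \<open>x \<in> D\<close> \<open>v \<in> tuples S V\<close> sub[OF \<open>A \<in> ?P\<close>]
      by (intro form_closed[OF c_form]) (auto simp: tuples_def)
    have "l x A (pure_tensor K A V (restrict v A)) = (\<Otimes>i\<in>A. c i (restrict x A i) (restrict v A i))"
      unfolding l_def using that sub[OF that(1)]
      by (intro tensor_basis.coord(2)[OF basis restr] restrict_tuples) auto
    also have "\<dots> = (\<Otimes>i\<in>A. c i (x i) (v i))"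
      using cc by (intro finprod_cong') auto
    finally show ?thesis .
  qed
  have lc: "l x A (w s A) \<in> carrier K" if "A \<in> ?P" "x \<in> D" "s < ?r" for x A s
    using form_closed[OF l[OF that(1,2)]] PiE_mem[OF w(1)[OF that(3), unfolded tuples_def] that(1)] .
  have sum: "coord x T = (\<Oplus>s\<in>{..<?r}. l x I (w s I) \<otimes> l x J (w s J))" if x: "x \<in> D" for x
  proof -
    obtain \<Psi> where \<Psi>: "\<Psi> \<in> linear_forms K P.TP"
      "\<And>u. u \<in> tuples ?P (block_products K V) \<Longrightarrow> \<Psi> (P.pure u) = (\<Otimes>A\<in>?P. l x A (u A))"
      using P.product_form[of "l x"] l[OF _ x] by auto
    interpret \<Psi>: mod_hom K P.TP "ring_module K" \<Psi>
      by (intro mod_hom.intro mod_hom_axioms.intro P.TP_module ring_module_module \<Psi>(1))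
    \<comment> \<open>The product runs over the set of blocks, so \<open>I \<noteq> J\<close> is
      what gives it two factors.\<close>
    have two: "(\<Otimes>A\<in>?P. f A) = f I \<otimes> f J" if "f I \<in> carrier K" "f J \<in> carrier K" for f
      using that P(2) by simp
    \<comment> \<open>Both sides are linear forms in \<open>T\<close>, so pure tensors decide; there
      the product of coordinates over all indices splits along \<open>I\<close> and
      \<open>J\<close>.\<close>
    have "coord x T = \<Psi> (?\<phi> T)"
    proof (rule hom_eqI[OF ring_module_module coord(1)[OF x] module_hom_comp[OF \<phi>(1) \<Psi>(1)] _ T])
      fix v assume v: "v \<in> tuples S V"
      have cc: "c i (x i) (v i) \<in> carrier K" if "i \<in> S" for i
        using that x v by (intro form_closed[OF c_form]) (auto simp: tuples_def)
      have fin: "finite I" "finite J" using IJ finite_S finite_subset by auto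
      have "(\<lambda>A\<in>?P. pure_tensor K A V (restrict v A)) \<in> tuples ?P (block_products K V)"
        unfolding tuples_def block_products_def
      proof (rule restrict_PiE_iff[THEN iffD2], rule ballI)
        fix A' assume A': "A' \<in> ?P"
        interpret A: tensor_basis K A' V B c by (rule basis[OF A'])
        show "pure_tensor K A' V (restrict v A') \<in> carrier (tensor_product K A' V)"
          using sub[OF A'] v by (intro A.pure_closed restrict_tuples)
      qed
      then have "\<Psi> (?\<phi> (pure v)) =
          (\<Otimes>A\<in>?P. l x A ((\<lambda>A\<in>?P. pure_tensor K A V (restrict v A)) A))"
        unfolding \<phi>(2)[OF v] by (rule \<Psi>(2))
      also have "\<dots> = l x I (pure_tensor K I V (restrict v I)) \<otimes> l x J (pure_tensor K J V (restrict v J))"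
        using cc IJ by (subst two) (auto simp: l_pure[OF _ x v] intro!: finprod_closed)
      also have "\<dots> = (\<Otimes>i\<in>I. c i (x i) (v i)) \<otimes> (\<Otimes>i\<in>J. c i (x i) (v i))"
        by (simp add: l_pure[OF _ x v])
      also have "\<dots> = (\<Otimes>i\<in>I \<union> J. c i (x i) (v i))"
        using cc IJ fin by (intro finprod_Un_disjoint[symmetric]) auto
      finally show "coord x (pure v) = \<Psi> (?\<phi> (pure v))"
        using coord(2)[OF x v] IJ(1) by simp
    qed
    also have "\<dots> = (\<Oplus>s\<in>{..<?r}. \<Psi> (P.pure (w s)))"
      using \<Psi>.hom_finsum[of "\<lambda>s. P.pure (w s)" "{..<?r}"] w P.pure_closed by (simp add: Pi_iff)
    also have "\<dots> = (\<Oplus>s\<in>{..<?r}. l x I (w s I) \<otimes> l x J (w s J))"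
      using \<Psi>(2)[OF w(1)] lc[OF _ x] by (intro finsum_cong') (auto simp: two P(2))
    finally show ?thesis .
  qed
  show ?thesis
  proof (rule exI[of _ "\<lambda>s x. l x I (w s I)"], rule exI[of _ "\<lambda>s x. l x J (w s J)"], intro conjI ballI)
    fix x y assume x: "x \<in> D" and y: "y \<in> D"
    \<comment> \<open>The mixed multi-index agrees with \<open>x\<close> on \<open>I\<close> and
      with \<open>y\<close> on \<open>J\<close>, which decouples the two factors.\<close>
    have "restrict (override_on y x I) I = restrict x I" by auto
    moreover have "restrict (override_on y x I) J = restrict y J"
      using IJ(2) by (auto simp: override_on_def restrict_def fun_eq_iff)
    ultimately show "coord (override_on y x I) T = (\<Oplus>s\<in>{..<?r}. l x I (w s I) \<otimes> l y J (w s J))"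
      using sum[OF override_on_PiE[OF x y]] by (simp add: l_def)
  next
    show "(\<lambda>s x. l x I (w s I)) \<in> {..<?r} \<rightarrow> D \<rightarrow> carrier K"
      "(\<lambda>s x. l x J (w s J)) \<in> {..<?r} \<rightarrow> D \<rightarrow> carrier K"
      using lc by simp_all
  qed
qed

theorem theorem5:
  fixes K :: "('a, 'm) ring_scheme"
    and V :: "nat \<Rightarrow> ('a, 'v, 'n) module_scheme"
    and k :: nat
    and T :: "((nat \<Rightarrow> 'v) \<Rightarrow> 'a) set"
    and C :: "nat set set set"
    and d_max :: nat
  assumes "field K"
    and "k \<ge> 1"
    and "\<And>i. i \<in> {1..k} \<Longrightarrow> vectorspace K (V i)"
    and "\<And>i. i \<in> {1..k} \<Longrightarrow> vectorspace.fin_dim K (V i)"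
    and "T \<in> carrier (tensor_product K {1..k} V)"
    and "separating_collection {1..k} C"
    and "d_max = Max ((\<lambda>P. flattening_rank K {1..k} V P T) ` C)"
  shows "tensor_rank K {1..k} V T \<le> d_max ^ (2 * (k - 1))"
proof -
  let ?S = "{1..k}"
  interpret K: field K by (rule assms(1))
  interpret tensor K ?S V
    by (intro tensor.intro tensor_axioms.intro K.cring_axioms vectorspace.axioms(1) assms(3))
  \<comment> \<open>Basis and coordinate forms are packed into a pair, so that a single choice
    yields both as functions of \<open>i\<close>.\<close>
  have "\<exists>p. finite (fst p) \<and> fst p \<subseteq> carrier (V i) \<and> (\<forall>b\<in>fst p. snd p b \<in> linear_forms K (V i)) \<and>
    (\<forall>b\<in>fst p. \<forall>b'\<in>fst p. snd p b b' = (if b' = b then \<one>\<^bsub>K\<^esub> else \<zero>\<^bsub>K\<^esub>)) \<and>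
    (\<forall>Z. submodule K Z (V i) \<longrightarrow> fst p \<subseteq> Z \<longrightarrow> carrier (V i) \<subseteq> Z)" if "i \<in> ?S" for i
    using vectorspace.finite_dual_basis[OF assms(3,4)[OF that]] by simp
  then obtain p where p: "\<And>i. i \<in> ?S \<Longrightarrow> finite (fst (p i)) \<and> fst (p i) \<subseteq> carrier (V i) \<and>
    (\<forall>b\<in>fst (p i). snd (p i) b \<in> linear_forms K (V i)) \<and>
    (\<forall>b\<in>fst (p i). \<forall>b'\<in>fst (p i). snd (p i) b b' = (if b' = b then \<one>\<^bsub>K\<^esub> else \<zero>\<^bsub>K\<^esub>)) \<and>
    (\<forall>Z. submodule K Z (V i) \<longrightarrow> fst (p i) \<subseteq> Z \<longrightarrow> carrier (V i) \<subseteq> Z)"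
    by metis
  interpret tensor_basis K ?S V "\<lambda>i. fst (p i)" "\<lambda>i. snd (p i)"
  proof (intro tensor_basis.intro tensor_basis_axioms.intro tensor_axioms)
    fix i b b' Z assume i: "i \<in> ?S"
    show "finite (fst (p i))" "fst (p i) \<subseteq> carrier (V i)"
      using p[OF i] by blast+
    show "snd (p i) b \<in> linear_forms K (V i)" if "b \<in> fst (p i)"
      using p[OF i] that by blast
    show "snd (p i) b b' = (if b' = b then \<one>\<^bsub>K\<^esub> else \<zero>\<^bsub>K\<^esub>)" if "b \<in> fst (p i)" "b' \<in> fst (p i)"
      using p[OF i] that by blast
    show "carrier (V i) \<subseteq> Z" if "submodule K Z (V i)" "fst (p i) \<subseteq> Z"
      using p[OF i] that by blast
  qed simp
  have "finite C"
  proof (rule finite_subset)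
    show "C \<subseteq> Pow (Pow ?S)"
      using assms(6) unfolding separating_collection_def partition_on_def by blast
  qed simp
  \<comment> \<open>For \<open>k = 1\<close> no partition into two blocks exists, so
    \<open>C\<close> is empty and \<open>Max\<close> is taken of the empty set; the bound is then
    \<open>d_max ^ 0\<close>, which is 1 whatever that value is.\<close>
  then have d_max: "flattening_rank K ?S V P T \<le> d_max" if "P \<in> C" for P
    unfolding assms(7) using that by (intro Max_ge) auto
  have slice: "sum_at_most K D (product_functions K ?S (\<lambda>i. fst (p i)) ?S) (d_max ^ (2 * (card ?S - 1)))
      (\<lambda>x. coord (override_on z x ?S) T)" if "z \<in> D" for z
  proof (rule K.slice_sum_at_most[where t = "\<lambda>x. coord x T"])
    show "(\<lambda>x. coord x T) \<in> D \<rightarrow> carrier K" using coord_closed assms(5) by blast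
    fix i j assume ij: "i \<in> ?S" "j \<in> ?S" "i \<noteq> j"
    then obtain I J where IJ: "{I, J} \<in> C" "i \<in> I" "j \<in> J"
      using assms(6) unfolding separating_collection_def by blast
    then have P: "partition_on ?S {I, J}" "I \<noteq> J"
      using assms(6) unfolding separating_collection_def by force+
    then have "j \<notin> I" using IJ(3) by (auto simp: partition_on_def disjoint_def)
    then show "\<exists>P r a b. i \<in> P \<and> j \<notin> P \<and> r \<le> d_max \<and> a \<in> {..<r} \<rightarrow> D \<rightarrow> carrier K \<and>
        b \<in> {..<r} \<rightarrow> D \<rightarrow> carrier K \<and>
        (\<forall>x\<in>D. \<forall>y\<in>D. coord (override_on y x P) T = (\<Oplus>\<^bsub>K\<^esub>s\<in>{..<r}. a s x \<otimes>\<^bsub>K\<^esub> b s y))"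
      using coord_flattening[OF P assms(5)] d_max[OF IJ(1)] IJ(2) by blast
  qed (use assms(2) that in auto)
  have "sum_at_most K D (product_functions K ?S (\<lambda>i. fst (p i)) ?S) (d_max ^ (2 * (k - 1)))
      (\<lambda>x. coord x T)"
  proof (cases "D = {}")
    \<comment> \<open>A factor of dimension zero leaves no multi-indices, and then the empty sum
      already represents the coordinate function.\<close>
    case True
    then show ?thesis by (intro sum_at_most.zero) blast
  next
    case False
    then obtain z where z: "z \<in> D" by blast
    \<comment> \<open>With every index free nothing is frozen, and the slice is the whole coordinate
      function.\<close>
    have "override_on z x ?S = x" if "x \<in> D" for x
      using that z by (auto simp: override_on_def PiE_iff extensional_def)
    then show ?thesis using sum_at_most_cong[OF slice[OF z]] by simp
  qed
  then show ?thesis using tensor_rank_le_sum_at_most assms(5) by blast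
qed

end
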